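(* Let $n\ge 1$ and let $f:\mathbb R^n\to\mathbb R$ satisfy the standing assumptions (A1)–(A3) stated in the context. Fix a family $\{x_t\}$ of global minimizers, $x_t\in\operatorname*{arg\,min}_{x\in\mathbb R^n}P_tf$. Then there exists $t_0>0$ such that the following holds. For every $t_*\in(0,t_0)$ there exist $\varepsilon>0$ (with $\varepsilon\le t_*$) and a unique $C^1$ map $y:(t_*-\varepsilon,t_*+\varepsilon)\to\mathbb R^n$ such that $$y(t_* )=x_{t_*}\qquad\text{and}\qquad \nabla_x(P_tf)(y(t))=0\quad\text{for all }t\in(t_*-\varepsilon,t_*+\varepsilon).$$ After possibly shrinking $\varepsilon$, one also has $$\nabla_x^2(P_tf)(y(t))\succ0\quad\text{for all }t\in(t_*-\varepsilon,t_*+\varepsilon).$$ In particular, $y$ is a nondegenerate local minimizing branch on $(t_*-\varepsilon,t_*+\varepsilon)$.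
   Context: Notation: $\|\cdot\|_2$ is the Euclidean norm on $\mathbb R^n$ and $B_\rho(0)=\{x:\|x\|_2<\rho\}$. For $t>0$ the heat kernel is $G_t(y)=\frac{1}{(4\pi t)^{n/2}}e^{-\|y\|_2^2/(4t)}$, and the heat-kernel regularization of $f$ is $(P_tf)(x)=\int_{\mathbb R^n}G_t(x-y)f(y)\,dy$. $\nabla_x,\nabla_x^2$ denote the gradient and Hessian in $x$, and $A\succ0$ means $A$ is positive definite. For $a\in[1,2]$, $\Phi_a(x)=\sum_{i=1}^n|x_i|^a$. Definitions: for an interval $J\subset(0,\infty)$, a critical-point branch of $P_tf$ on $J$ is a map $x\in C^1(J;\mathbb R^n)$ with $\nabla_x(P_tf)(x_t)=0$ for all $t\in J$. It is a nondegenerate local minimizing branch if moreover $\nabla_x^2(P_tf)(x_t)\succ0$ for all $t\in J$. Standing assumptions on the (Lebesgue measurable) function $f:\mathbb R^n\to\mathbb R$: (A1) Global quadratic lower bound: there is a constant $c>0$ with $f(x)\ge c\|x\|_2^2$ for all $x\in\mathbb R^n$. The distinguished minimizer is at the origin, with $f(0)=0$. (A2) Local leading-order profile: there exist $a\in[1,2]$, $r_0>0$, a function $r:\mathbb R^n\to\mathbb R$ and a function $\omega:[0,r_0)\to[0,\infty)$ with $\lim_{\rho\to0^+}\omega(\rho)=0$ such that $f(x)=\Phi_a(x)+r(x)$ and $|r(x)|\le\omega(\|x\|_2)\,\Phi_a(x)$ for all $x\in B_{r_0}(0)$. (A3) Polynomial tail control: there exist constants $C>0$ and $m\ge2$ such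 that $f(x)\le C(1+\|x\|_2^m)$ for all $x\in\mathbb R^n$. *)

theory Defs
  imports "HOL-Analysis.Analysis"
begin

definition heat_kernel :: "real \<Rightarrow> real ^ 'n \<Rightarrow> real" where
  "heat_kernel t y =
     1 / (4 * pi * t) powr (real CARD('n) / 2) * exp (- (norm y)\<^sup>2 / (4 * t))"

definition heat_reg :: "(real ^ 'n \<Rightarrow> real) \<Rightarrow> real \<Rightarrow> real ^ 'n \<Rightarrow> real" where
  "heat_reg f t x = integral\<^sup>L lebesgue (\<lambda>y. heat_kernel t (x - y) * f y)"

definition Phi :: "real \<Rightarrow> real ^ 'n \<Rightarrow> real" where
  "Phi a x = (\<Sum>i\<in>UNIV. \<bar>x $ i\<bar> powr a)"

definition quadratic_lower_bound :: "(real ^ 'n \<Rightarrow> real) \<Rightarrow> bool" where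
  "quadratic_lower_bound f \<longleftrightarrow> (\<exists>c>0. \<forall>x. f x \<ge> c * (norm x)\<^sup>2) \<and> f 0 = 0"

(* omega is only constrained on [0, r0); its values elsewhere are irrelevant. *)
definition leading_order_profile :: "(real ^ 'n \<Rightarrow> real) \<Rightarrow> bool" where
  "leading_order_profile f \<longleftrightarrow>
     (\<exists>a\<in>{1..2}. \<exists>r0>0. \<exists>(r :: real ^ 'n \<Rightarrow> real) (\<omega> :: real \<Rightarrow> real).
        (\<forall>\<rho>\<in>{0..<r0}. \<omega> \<rho> \<ge> 0) \<and>
        (\<omega> \<longlongrightarrow> 0) (at_right 0) \<and>
        (\<forall>x\<in>ball 0 r0. f x = Phi a x + r x \<and> \<bar>r x\<bar> \<le> \<omega> (norm x) * Phi a x))"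

(* The exponent m is a real number, not necessarily an integer. *)
definition polynomial_tail :: "(real ^ 'n \<Rightarrow> real) \<Rightarrow> bool" where
  "polynomial_tail f \<longleftrightarrow>
     (\<exists>C>0. \<exists>m\<ge>(2::real). \<forall>x. f x \<le> C * (1 + norm x powr m))"

(* H is the derivative at x of the gradient field of g, which is required to exist
   in a neighbourhood of x. *)
definition has_hessian ::
  "(real ^ 'n \<Rightarrow> real) \<Rightarrow> real ^ 'n \<Rightarrow> real ^ 'n ^ 'n \<Rightarrow> bool" where
  "has_hessian g x H \<longleftrightarrow>
     (\<exists>D. (\<forall>\<^sub>F z in nhds x. GDERIV g z :> D z) \<and> (D has_derivative (\<lambda>v. H *v v)) (at x))"

definition pos_definite :: "real ^ 'n ^ 'n \<Rightarrow> bool" where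
  "pos_definite A \<longleftrightarrow> transpose A = A \<and> (\<forall>v. v \<noteq> 0 \<longrightarrow> v \<bullet> (A *v v) > 0)"

(* C1_differentiable_on uses two-sided derivatives, so this is the usual notion of a C^1
   branch for open intervals J. *)
definition critical_point_branch ::
  "(real ^ 'n \<Rightarrow> real) \<Rightarrow> real set \<Rightarrow> (real \<Rightarrow> real ^ 'n) \<Rightarrow> bool" where
  "critical_point_branch f J y \<longleftrightarrow>
     is_interval J \<and> J \<subseteq> {0<..} \<and> y C1_differentiable_on J \<and>
     (\<forall>t\<in>J. GDERIV (heat_reg f t) (y t) :> 0)"

definition nondegenerate_local_minimizing_branch ::
  "(real ^ 'n \<Rightarrow> real) \<Rightarrow> real set \<Rightarrow> (real \<Rightarrow> real ^ 'n) \<Rightarrow> bool" where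
  "nondegenerate_local_minimizing_branch f J y \<longleftrightarrow>
     critical_point_branch f J y \<and>
     (\<forall>t\<in>J. \<exists>H. has_hessian (heat_reg f t) (y t) H \<and> pos_definite H)"

end

theory Submission
  imports Defs "HOL-Probability.Distributions"
begin

text \<open>
  Expanding the square in the heat kernel gives
  $P_t f(x) = c(t)\, e^{-|x|^2/4t} L_f(b,s)$ with $b = x/2t$, $s = 1/4t$ and
  $L_f(b,s) = \int e^{b\cdot u - s|u|^2} f(u)\,du$. Differentiating $L_f$ only inserts polynomial
  factors, so $L_f$ is smooth, and $x$ is critical for $P_t f$ iff
  $R(b,s) = 2s\,L_{uf}(b,s) - L_f(b,s)\,b$ vanishes; at critical points the Hessian is a positive
  multiple of $\partial_b R$. If the latter is positive definite, the inverse function theorem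
  for $(b,s) \mapsto (R(b,s),s)$ yields the branch and its local uniqueness.

  Positive definiteness at $x_t$ for small $t$ follows by rescaling with $\sqrt t$. The functions
  $t^{-a/2} f(\sqrt t\,u)$ converge to $\Phi_a(u)$, with a common lower bound that keeps
  $x_t/\sqrt t$ bounded and a common integrable upper bound. Along a sequence violating
  positivity the quadratic forms would therefore converge to that of $\Phi_a$ at some point
  $\xi$ and unit vector $v$, which is positive.
\<close>

section \<open>Gaussian integrals against functions of exponential growth\<close>

text \<open>At \<open>a = 1\<close> the limit profile is not differentiable, so every derivative is
  kept on the Gaussian: the Hessian becomes the integral \<open>gauss_form\<close>, and for its
  convergence pointwise limits of the profiles and one majorant suffice. The limit point of the
  rescaled minimizers is not identified, so positivity is proved at every centre; this succeeds
  because \<open>Phi a\<close> is a sum of convex functions of one coordinate each, which makes the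
  form diagonal. The common bounds rest on a <= 2 <= m: away from the origin, rescaling leaves the
  powers 2 - a in the lower bound and m - a in the upper bound, both nonnegative. Criticality does
  two jobs: it removes the derivative of the positive prefactor from the Hessian, and it fixes the
  first moment of the weighted Gaussian, which makes the derivative of R in b symmetric and equal to
  the Hessian form up to a positive factor. The inverse function theorem compares only solutions
  that stay in a neighbourhood of the base point; a competing branch is not known to stay there, and
  connectedness of the interval supplies this.\<close>

lemma integrable_exp_neg_norm_square:
  assumes s: "s > 0"
  shows "integrable lborel (\<lambda>u::'a::euclidean_space. exp (- s * (norm u)\<^sup>2))"
proof (rule integrableI_bounded)
  have 1: "integrable lborel (\<lambda>x::real. exp (- s * x\<^sup>2))"
  proof -
    \<comment> \<open>Variance 1/(2s) turns the normal exponent into -s x^2, and sqrt(pi/s) cancels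
      the normalization. The higher-dimensional Gaussian then factors over
      \<open>Basis\<close>.\<close>
    have "integrable lborel (\<lambda>x. sqrt (pi / s) * normal_density 0 (1 / sqrt (2 * s)) x)"
      using s by simp
    also have "(\<lambda>x. sqrt (pi / s) * normal_density 0 (1 / sqrt (2 * s)) x) = (\<lambda>x. exp (- s * x\<^sup>2))"
      using s by (auto simp: normal_density_def power_divide real_sqrt_divide real_sqrt_mult field_simps)
    finally show ?thesis .
  qed
  have e: "ennreal (norm (exp (- s * (norm u)\<^sup>2))) = (\<Prod>b\<in>Basis. ennreal (exp (- s * (u \<bullet> b)\<^sup>2)))" for u :: 'a
  proof -
    have "(norm u)\<^sup>2 = (\<Sum>b\<in>Basis. (u \<bullet> b)\<^sup>2)"
      unfolding power2_norm_eq_inner by (subst euclidean_inner) (simp add: power2_eq_square)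
    then have "exp (- s * (norm u)\<^sup>2) = (\<Prod>b\<in>Basis. exp (- s * (u \<bullet> b)\<^sup>2))"
      by (simp add: sum_distrib_left exp_sum flip: sum_negf)
    then show ?thesis by (simp add: prod_ennreal abs_prod)
  qed
  have "(\<integral>\<^sup>+u. ennreal (norm (exp (- s * (norm (u::'a))\<^sup>2))) \<partial>lborel)
      = (\<Prod>b\<in>(Basis::'a set). \<integral>\<^sup>+x. ennreal (exp (- s * x\<^sup>2)) \<partial>lborel)"
    unfolding e by (rule nn_integral_lborel_prod) auto
  also have "\<dots> < \<infinity>"
  proof -
    have "(\<integral>\<^sup>+x. ennreal (exp (- s * x\<^sup>2)) \<partial>lborel) < \<infinity>"
      using 1 by (auto simp: integrable_iff_bounded)
    then show ?thesis by (simp add: power_less_top_ennreal)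
  qed
  finally show "(\<integral>\<^sup>+u. ennreal (norm (exp (- s * (norm (u::'a))\<^sup>2))) \<partial>lborel) < \<infinity>" .
qed auto

text \<open>A class that every Gaussian integrates and that is closed under sums, products,
  polynomial weights and dilations. Exponential rather than polynomial growth avoids bookkeeping of
  degrees, in particular of the real exponents \<open>a\<close> and \<open>m\<close>.\<close>

definition exp_growth :: "('a::euclidean_space \<Rightarrow> 'b::euclidean_space) \<Rightarrow> bool" where
  "exp_growth g \<longleftrightarrow>
     g \<in> borel_measurable lebesgue \<and> (\<exists>C k. \<forall>u. norm (g u) \<le> C * exp (k * norm u))"

lemma exp_growthE:
  assumes "exp_growth g"
  obtains C k where "C \<ge> 0" "k \<ge> 0" "\<And>u. norm (g u) \<le> C * exp (k * norm u)"
proof -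
  obtain C k where *: "\<And>u. norm (g u) \<le> C * exp (k * norm u)"
    using assms by (auto simp: exp_growth_def)
  have "0 \<le> C" using *[of 0] norm_ge_zero[of "g 0"] by (simp del: norm_ge_zero)
  have "norm (g u) \<le> C * exp (\<bar>k\<bar> * norm u)" for u
    by (rule order_trans[OF *]) (auto intro!: mult_left_mono mult_right_mono \<open>0 \<le> C\<close>)
  then show ?thesis using that[of C "\<bar>k\<bar>"] \<open>0 \<le> C\<close> by auto
qed

lemma exp_growth_measurable [measurable_dest]: "exp_growth g \<Longrightarrow> g \<in> borel_measurable lebesgue"
  by (simp add: exp_growth_def)

lemma borel_measurable_lebesgue_continuous:
  "continuous_on UNIV g \<Longrightarrow> g \<in> borel_measurable lebesgue"
  by (rule measurable_completion) (simp add: borel_measurable_continuous_onI)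

lemma exp_growth_scaleR:
  assumes h: "exp_growth h" and g: "exp_growth g"
  shows "exp_growth (\<lambda>u. h u *\<^sub>R g u)"
proof -
  obtain C k where 1: "C \<ge> 0" "\<And>u. norm (h u) \<le> C * exp (k * norm u)" using exp_growthE[OF h] by metis
  obtain C' k' where 2: "\<And>u. norm (g u) \<le> C' * exp (k' * norm u)" using exp_growthE[OF g] by metis
  have "norm (h u *\<^sub>R g u) \<le> (C * C') * exp ((k + k') * norm u)" for u
  proof -
    have "norm (h u *\<^sub>R g u) \<le> (C * exp (k * norm u)) * (C' * exp (k' * norm u))"
      unfolding norm_scaleR real_norm_def[symmetric] by (intro mult_mono 1 2) (auto simp: 1)
    then show ?thesis by (simp add: algebra_simps exp_add)
  qed
  moreover have "(\<lambda>u. h u *\<^sub>R g u) \<in> borel_measurable lebesgue" using h g by measurable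
  ultimately show ?thesis unfolding exp_growth_def by blast
qed

lemma exp_growth_mult:
  fixes h g :: "'a::euclidean_space \<Rightarrow> real"
  shows "exp_growth h \<Longrightarrow> exp_growth g \<Longrightarrow> exp_growth (\<lambda>u. h u * g u)"
  using exp_growth_scaleR[of h g] by simp

lemma exp_growth_add:
  assumes h: "exp_growth h" and g: "exp_growth g"
  shows "exp_growth (\<lambda>u. h u + g u)"
proof -
  obtain C k where 1: "C \<ge> 0" "k \<ge> 0" "\<And>u. norm (h u) \<le> C * exp (k * norm u)" using exp_growthE[OF h] by metis
  obtain C' k' where 2: "C' \<ge> 0" "k' \<ge> 0" "\<And>u. norm (g u) \<le> C' * exp (k' * norm u)" using exp_growthE[OF g] by metis
  have "norm (h u + g u) \<le> (C + C') * exp ((k + k') * norm u)" for u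
  proof -
    have "C * exp (k * norm u) \<le> C * exp ((k + k') * norm u)" "C' * exp (k' * norm u) \<le> C' * exp ((k + k') * norm u)"
      using 1 2 by (auto intro!: mult_left_mono mult_right_mono)
    then show ?thesis using norm_triangle_ineq[of "h u" "g u"] 1(3)[of u] 2(3)[of u] 
      by (simp add: distrib_right)
  qed
  moreover have "(\<lambda>u. h u + g u) \<in> borel_measurable lebesgue" using h g by measurable
  ultimately show ?thesis unfolding exp_growth_def by blast
qed

lemma exp_growth_const [simp]: "exp_growth (\<lambda>u. c)"
  unfolding exp_growth_def by (intro conjI exI[of _ "norm c"] exI[of _ 0]) auto

lemma le_exp_self: "(x::real) \<le> exp x"
  using exp_ge_add_one_self[of x] by linarith

lemma exp_growth_ident [simp]: "exp_growth (\<lambda>u. u)"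
  unfolding exp_growth_def
  by (intro conjI exI[of _ 1]) (auto simp: le_exp_self intro!: borel_measurable_lebesgue_continuous)

lemma exp_growth_norm [simp]: "exp_growth (\<lambda>u. norm u)"
  unfolding exp_growth_def
  by (intro conjI exI[of _ 1]) (auto simp: le_exp_self intro!: borel_measurable_lebesgue_continuous continuous_intros)

lemma exp_growth_inner [simp]: "exp_growth (\<lambda>u::'a::euclidean_space. v \<bullet> u)"
  unfolding exp_growth_def
proof (intro conjI, goal_cases)
  case 2 show ?case
  proof (rule exI[of _ "norm v"], rule exI[of _ 1], rule allI)
  fix u :: 'a show "norm (v \<bullet> u) \<le> norm v * exp (1 * norm u)"
    using Cauchy_Schwarz_ineq2[of v u] mult_left_mono[OF le_exp_self[of "norm u"] norm_ge_zero[of v]] by simp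
  qed
qed (auto intro!: borel_measurable_lebesgue_continuous continuous_intros)

lemma exp_growth_norm_image:
  assumes "exp_growth g" shows "exp_growth (\<lambda>u. norm (g u))"
  using assms unfolding exp_growth_def by (auto intro: borel_measurable_norm)

text \<open>Half of the quadratic decay absorbs all linear exponents: (b + k) r <= (b + k)^2/(2s) +
  (s/2) r^2 by completing the square. The term \<open>b * norm u\<close> lets one integrand dominate
  every linear tilt of size at most \<open>b\<close>.\<close>

lemma integrable_gaussian_exp_growth:
  fixes g :: "'a::euclidean_space \<Rightarrow> 'b::euclidean_space"
  assumes s: "s > 0" and g: "exp_growth g"
  shows "integrable lebesgue (\<lambda>u. exp (b * norm u - s * (norm u)\<^sup>2) *\<^sub>R g u)"
proof -
  obtain C k where 1: "C \<ge> 0" "\<And>u. norm (g u) \<le> C * exp (k * norm u)" using exp_growthE[OF g] by metis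
  have [measurable]: "(\<lambda>u::'a. exp (b * norm u - s * (norm u)\<^sup>2)) \<in> borel_measurable lebesgue"
    by (intro borel_measurable_lebesgue_continuous continuous_intros)
  have "integrable lborel (\<lambda>u::'a. C * exp ((b + k)\<^sup>2 / (2 * s)) * exp (- (s / 2) * (norm u)\<^sup>2))"
    using s by (intro integrable_mult_right integrable_exp_neg_norm_square) auto
  then have i: "integrable lebesgue (\<lambda>u::'a. C * exp ((b + k)\<^sup>2 / (2 * s)) * exp (- (s / 2) * (norm u)\<^sup>2))"
    by (subst integrable_completion) auto
  show ?thesis
  proof (rule Bochner_Integration.integrable_bound[OF i])
    show "AE u in lebesgue. norm (exp (b * norm u - s * (norm u)\<^sup>2) *\<^sub>R g u)
        \<le> norm (C * exp ((b + k)\<^sup>2 / (2 * s)) * exp (- (s / 2) * (norm u)\<^sup>2))"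
    proof (rule AE_I2)
      fix u :: 'a
      define r where "r = norm u"
      have "(b + k) * r - s * r\<^sup>2 \<le> (b + k)\<^sup>2 / (2 * s) + (- (s / 2) * r\<^sup>2)"
      proof -
        have "(b + k)\<^sup>2 / (2 * s) + (- (s / 2) * r\<^sup>2) - ((b + k) * r - s * r\<^sup>2) = (b + k - s * r)\<^sup>2 / (2 * s)"
          using s by (simp add: field_simps power2_eq_square)
        also have "\<dots> \<ge> 0" using s by simp
        finally show ?thesis by linarith
      qed
      then have e: "exp ((b + k) * r - s * r\<^sup>2) \<le> exp ((b + k)\<^sup>2 / (2 * s)) * exp (- (s / 2) * r\<^sup>2)"
        unfolding exp_add[symmetric] by simp
      have "norm (exp (b * r - s * r\<^sup>2) *\<^sub>R g u) \<le> exp (b * r - s * r\<^sup>2) * (C * exp (k * r))"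
        using 1(2)[of u] by (simp add: r_def)
      also have "\<dots> = C * exp ((b + k) * r - s * r\<^sup>2)"
        by (simp add: algebra_simps flip: exp_add)
      also have "\<dots> \<le> C * (exp ((b + k)\<^sup>2 / (2 * s)) * exp (- (s / 2) * r\<^sup>2))"
        using e 1 by (intro mult_left_mono)
      finally show "norm (exp (b * norm u - s * (norm u)\<^sup>2) *\<^sub>R g u)
        \<le> norm (C * exp ((b + k)\<^sup>2 / (2 * s)) * exp (- (s / 2) * (norm u)\<^sup>2))"
        using 1 by (simp add: r_def abs_mult)
    qed
  qed (use g in measurable)
qed

section \<open>Laplace integrals with a Gaussian weight and their derivative in the
  parameter\<close>

definition phase :: "'a::euclidean_space \<times> real \<Rightarrow> 'a \<Rightarrow> real" where
  "phase z u = fst z \<bullet> u - snd z * (norm u)\<^sup>2"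

text \<open>Vector values are allowed so that the same differentiation lemma covers
  \<open>f u\<close> and the moment \<open>f u *\<^sub>R u\<close>. Since \<open>phase\<close> is
  linear in the parameter, no further class of integrals arises from differentiating.\<close>

definition gauss_laplace ::
  "('a::euclidean_space \<Rightarrow> 'b::euclidean_space) \<Rightarrow> 'a \<times> real \<Rightarrow> 'b" where
  "gauss_laplace g z = (LINT u|lebesgue. exp (phase z u) *\<^sub>R g u)"

lemma phase_add: "phase (z + h) u = phase z u + phase h u"
  by (simp add: phase_def algebra_simps)

lemma phase_scaleR: "phase (c *\<^sub>R z) u = c * phase z u"
  by (simp add: phase_def algebra_simps)

lemma exp_growth_phase [simp]: "exp_growth (phase h)"
proof -
  have "phase h = (\<lambda>u. fst h \<bullet> u + (- snd h) * (norm u * norm u))"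
    by (auto simp: phase_def power2_eq_square)
  then show ?thesis
    by (simp only:) (intro exp_growth_add exp_growth_mult; simp)
qed

lemma phase_bound: "phase z u \<le> norm (fst z) * norm u - snd z * (norm u)\<^sup>2"
  using norm_cauchy_schwarz[of "fst z" u] by (simp add: phase_def)

lemma abs_phase_bound: "\<bar>phase h u\<bar> \<le> norm h * (norm u + (norm u)\<^sup>2)"
proof -
  have "\<bar>phase h u\<bar> \<le> \<bar>fst h \<bullet> u\<bar> + \<bar>snd h * (norm u)\<^sup>2\<bar>" by (simp add: phase_def)
  also have "\<dots> \<le> norm h * norm u + norm h * (norm u)\<^sup>2"
  proof (intro add_mono)
    show "\<bar>fst h \<bullet> u\<bar> \<le> norm h * norm u"
      by (rule order_trans[OF Cauchy_Schwarz_ineq2]) (auto intro!: mult_right_mono norm_fst_le[of "fst h" "snd h", simplified])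
    show "\<bar>snd h * (norm u)\<^sup>2\<bar> \<le> norm h * (norm u)\<^sup>2"
      using norm_snd_le[of "snd h" "fst h"] by (auto simp: abs_mult intro!: mult_right_mono)
  qed
  finally show ?thesis by (simp add: distrib_left)
qed

lemma phase_measurable [measurable]: "phase z \<in> borel_measurable lebesgue"
  by (simp add: exp_growth_measurable)

lemma integrable_gauss_laplace:
  assumes z: "snd z > 0" and g: "exp_growth g"
  shows "integrable lebesgue (\<lambda>u. exp (phase z u) *\<^sub>R g u)"
proof (rule Bochner_Integration.integrable_bound[OF integrable_gaussian_exp_growth[OF z g, of "norm (fst z)"]])
  show "AE u in lebesgue. norm (exp (phase z u) *\<^sub>R g u)
      \<le> norm (exp (norm (fst z) * norm u - snd z * (norm u)\<^sup>2) *\<^sub>R g u)"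
    using phase_bound[of z] by (auto intro!: mult_right_mono)
qed (use g in measurable)

lemma gauss_laplace_add:
  assumes "snd z > 0" "exp_growth g" "exp_growth h"
  shows "gauss_laplace (\<lambda>u. g u + h u) z = gauss_laplace g z + gauss_laplace h z"
  using assms by (simp add: gauss_laplace_def scaleR_add_right integrable_gauss_laplace)

lemma gauss_laplace_scaleR: "gauss_laplace (\<lambda>u. c *\<^sub>R g u) z = c *\<^sub>R gauss_laplace g z"
proof -
  have "gauss_laplace (\<lambda>u. c *\<^sub>R g u) z = (LINT u|lebesgue. c *\<^sub>R (exp (phase z u) *\<^sub>R g u))"
    by (simp add: gauss_laplace_def algebra_simps)
  then show ?thesis by (simp only: integral_scaleR_right gauss_laplace_def)
qed

lemma gauss_laplace_inner:
  assumes "snd z > 0" "exp_growth g"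
  shows "v \<bullet> gauss_laplace g z = gauss_laplace (\<lambda>u. v \<bullet> g u) z"
  using integral_inner_right[OF integrable_gauss_laplace[OF assms], of v]
  by (simp add: gauss_laplace_def)

lemma abs_exp_minus_taylor1: "\<bar>exp d - 1 - d\<bar> \<le> d\<^sup>2 * exp \<bar>d\<bar>" for d :: real
proof -
  obtain t where t: "\<bar>t\<bar> \<le> \<bar>d\<bar>" "exp d = (\<Sum>m<2. d ^ m / fact m) + exp t / fact 2 * d ^ 2"
    using Maclaurin_exp_le[of d 2] by auto
  then have "\<bar>exp d - 1 - d\<bar> = exp t / 2 * d\<^sup>2" by (simp add: numeral_2_eq_2)
  also have "\<dots> \<le> exp \<bar>d\<bar> * d\<^sup>2"
    using t(1) by (intro mult_right_mono) (auto intro: order_trans[of _ "exp \<bar>d\<bar>"])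
  finally show ?thesis by (simp add: mult.commute)
qed

text \<open>Lets a pointwise second-order Taylor estimate be integrated directly, so that
  differentiating under the integral needs no limit theorem.\<close>

lemma has_derivative_quadratic_bound:
  fixes F :: "'a::real_normed_vector \<Rightarrow> 'b::real_normed_vector"
  assumes "bounded_linear D" "\<epsilon> > 0"
    and b: "\<And>h. norm h \<le> \<epsilon> \<Longrightarrow> norm (F (z + h) - F z - D h) \<le> K * (norm h)\<^sup>2"
  shows "(F has_derivative D) (at z)"
  unfolding has_derivative_at
proof
  show "(\<lambda>h. norm (F (z + h) - F z - D h) / norm h) \<midarrow>0\<rightarrow> 0"
  proof (rule Lim_null_comparison[where g = "\<lambda>h. K * norm h"])
    show "\<forall>\<^sub>F h in at 0. norm (norm (F (z + h) - F z - D h) / norm h) \<le> K * norm h"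
      unfolding eventually_at
      using b \<open>\<epsilon> > 0\<close> by (intro exI[of _ \<epsilon>]) (auto simp: divide_simps power2_eq_square mult.assoc)
    show "(\<lambda>h. K * norm h) \<midarrow>0\<rightarrow> 0" by (intro tendsto_eq_intros) auto
  qed
qed fact

lemma has_derivative_gauss_laplace:
  fixes g :: "'a::euclidean_space \<Rightarrow> 'b::euclidean_space"
  assumes z: "snd z > 0" and g: "exp_growth g"
  shows "(gauss_laplace g has_derivative (\<lambda>h. gauss_laplace (\<lambda>u. phase h u *\<^sub>R g u) z)) (at z)"
proof -
  \<comment> \<open>A perturbation of norm at most \<open>\<epsilon>\<close> costs at most half of
    the Gaussian decay.\<close>
  define \<epsilon> where "\<epsilon> = snd z / 2"
  have \<epsilon>: "\<epsilon> > 0" "snd z - \<epsilon> > 0" using z by (auto simp: \<epsilon>_def)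
  \<comment> \<open>The Taylor remainder of the exponential is at most d^2 exp |d| with d =
    \<open>phase h u\<close>. The exponential part shifts both coefficients by
    \<open>\<epsilon>\<close>; the square gives (|h| (r + r^2))^2 with r = |u|, from which |h|^2 is
    factored out.\<close>
  define M where "M u = exp ((norm (fst z) + \<epsilon>) * norm u - (snd z - \<epsilon>) * (norm u)\<^sup>2) *
      ((norm u + (norm u)\<^sup>2)\<^sup>2 * norm (g u))" for u
  have "exp_growth (\<lambda>u. (norm u + norm u * norm u) * (norm u + norm u * norm u) * norm (g u))"
    using g by (intro exp_growth_mult exp_growth_add exp_growth_norm_image) auto
  then have "exp_growth (\<lambda>u. (norm u + (norm u)\<^sup>2)\<^sup>2 * norm (g u))"
    by (simp add: power2_eq_square)
  from integrable_gaussian_exp_growth[OF \<epsilon>(2) this]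
  have M: "integrable lebesgue M" by (simp add: M_def[abs_def])
  have gp: "exp_growth (\<lambda>u. phase h u *\<^sub>R g u)" for h :: "'a \<times> real"
    using g by (intro exp_growth_scaleR) simp_all
  show ?thesis
  proof (rule has_derivative_quadratic_bound[OF _ \<epsilon>(1)])
    show "bounded_linear (\<lambda>h. gauss_laplace (\<lambda>u. phase h u *\<^sub>R g u) z)"
      unfolding linear_conv_bounded_linear[symmetric]
    proof (intro linearI)
      show "gauss_laplace (\<lambda>u. phase (h + k) u *\<^sub>R g u) z =
        gauss_laplace (\<lambda>u. phase h u *\<^sub>R g u) z + gauss_laplace (\<lambda>u. phase k u *\<^sub>R g u) z" for h k
        by (simp add: phase_add scaleR_add_left gauss_laplace_add z gp)
      show "gauss_laplace (\<lambda>u. phase (c *\<^sub>R h) u *\<^sub>R g u) z =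
        c *\<^sub>R gauss_laplace (\<lambda>u. phase h u *\<^sub>R g u) z" for c h
        by (simp add: phase_scaleR gauss_laplace_scaleR flip: scaleR_scaleR)
    qed
    fix h :: "'a \<times> real" assume h: "norm h \<le> \<epsilon>"
    have "snd (z + h) > 0"
      using h z norm_snd_le[of "snd h" "fst h"] by (simp add: \<epsilon>_def)
    then have i: "integrable lebesgue (\<lambda>u. exp (phase (z + h) u) *\<^sub>R g u)"
      using g by (rule integrable_gauss_laplace)
    have eq: "gauss_laplace g (z + h) - gauss_laplace g z - gauss_laplace (\<lambda>u. phase h u *\<^sub>R g u) z
      = (LINT u|lebesgue. exp (phase (z + h) u) *\<^sub>R g u - exp (phase z u) *\<^sub>R g u - exp (phase z u) *\<^sub>R (phase h u *\<^sub>R g u))"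
      unfolding gauss_laplace_def
      by (simp only: Bochner_Integration.integral_diff Bochner_Integration.integrable_diff i
          integrable_gauss_laplace[OF z g] integrable_gauss_laplace[OF z gp])
    have "norm (gauss_laplace g (z + h) - gauss_laplace g z - gauss_laplace (\<lambda>u. phase h u *\<^sub>R g u) z)
      \<le> (LINT u|lebesgue. (norm h)\<^sup>2 * M u)"
      unfolding eq
    proof (rule Bochner_Integration.integral_norm_bound_integral)
      show "integrable lebesgue (\<lambda>u. exp (phase (z + h) u) *\<^sub>R g u - exp (phase z u) *\<^sub>R g u - exp (phase z u) *\<^sub>R (phase h u *\<^sub>R g u))"
        by (intro Bochner_Integration.integrable_diff i integrable_gauss_laplace[OF z] g gp)
      show "integrable lebesgue (\<lambda>u. (norm h)\<^sup>2 * M u)" using M by simp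
      fix u :: 'a
      let ?r = "norm u" and ?d = "phase h u"
      have "norm (exp (phase (z + h) u) *\<^sub>R g u - exp (phase z u) *\<^sub>R g u - exp (phase z u) *\<^sub>R (?d *\<^sub>R g u))
        = norm ((exp (phase z u) * (exp ?d - 1 - ?d)) *\<^sub>R g u)"
        by (simp add: phase_add exp_add algebra_simps)
      also have "\<dots> = exp (phase z u) * \<bar>exp ?d - 1 - ?d\<bar> * norm (g u)"
        by (simp add: abs_mult)
      also have "\<dots> \<le> exp (phase z u) * (?d\<^sup>2 * exp \<bar>?d\<bar>) * norm (g u)"
        by (intro mult_right_mono mult_left_mono abs_exp_minus_taylor1) auto
      also have "\<dots> = exp (phase z u + \<bar>?d\<bar>) * (\<bar>?d\<bar>\<^sup>2 * norm (g u))"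
        by (simp add: exp_add)
      also have "\<dots> \<le> exp ((norm (fst z) + \<epsilon>) * ?r - (snd z - \<epsilon>) * ?r\<^sup>2) * ((norm h * (?r + ?r\<^sup>2))\<^sup>2 * norm (g u))"
      proof (intro mult_mono power_mono abs_phase_bound)
        have "norm h * (?r + ?r\<^sup>2) \<le> \<epsilon> * (?r + ?r\<^sup>2)" using h by (intro mult_right_mono) auto
        then have "phase z u + \<bar>?d\<bar> \<le> (norm (fst z) + \<epsilon>) * ?r - (snd z - \<epsilon>) * ?r\<^sup>2"
          using phase_bound[of z u] abs_phase_bound[of h u] by (simp add: algebra_simps)
        then show "exp (phase z u + \<bar>?d\<bar>) \<le> exp ((norm (fst z) + \<epsilon>) * ?r - (snd z - \<epsilon>) * ?r\<^sup>2)" by simp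
      qed auto
      also have "\<dots> = (norm h)\<^sup>2 * M u" by (simp add: M_def power_mult_distrib)
      finally show "norm (exp (phase (z + h) u) *\<^sub>R g u - exp (phase z u) *\<^sub>R g u - exp (phase z u) *\<^sub>R (?d *\<^sub>R g u))
        \<le> (norm h)\<^sup>2 * M u" .
    qed
    then show "norm (gauss_laplace g (z + h) - gauss_laplace g z - gauss_laplace (\<lambda>u. phase h u *\<^sub>R g u) z)
      \<le> (LINT u|lebesgue. M u) * (norm h)\<^sup>2" by (simp add: mult.commute)
  qed
qed

lemma continuous_on_gauss_laplace:
  assumes "exp_growth g"
  shows "continuous_on {z. snd z > 0} (gauss_laplace g)"
  using has_derivative_gauss_laplace[OF _ assms] has_derivative_continuous
  by (intro continuous_at_imp_continuous_on) blast

section \<open>Positivity of the Gaussian quadratic form of the model profile\<close>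

lemma
  fixes t :: "'a::euclidean_space" and c :: real
  assumes c: "c \<noteq> 0"
  shows lebesgue_eq_density_affine:
      "lebesgue = density (distr lebesgue lebesgue (\<lambda>x. t + c *\<^sub>R x)) (\<lambda>_. ennreal (\<bar>c\<bar> ^ DIM('a)))"
    and measurable_lebesgue_affine: "(\<lambda>x. t + c *\<^sub>R x) \<in> lebesgue \<rightarrow>\<^sub>M lebesgue"
proof -
  have eq: "(\<lambda>x. t + c *\<^sub>R x) = (\<lambda>x. t + (\<Sum>j\<in>Basis. (c * (x \<bullet> j)) *\<^sub>R j))"
    by (auto simp: euclidean_representation simp flip: scaleR_scaleR scaleR_sum_right)
  show "lebesgue = density (distr lebesgue lebesgue (\<lambda>x. t + c *\<^sub>R x)) (\<lambda>_. ennreal (\<bar>c\<bar> ^ DIM('a)))"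
    using lebesgue_affine_euclidean[of "\<lambda>_. c" t] c unfolding eq by simp
  show "(\<lambda>x. t + c *\<^sub>R x) \<in> lebesgue \<rightarrow>\<^sub>M lebesgue"
    using lebesgue_affine_measurable[of "\<lambda>_. c" t] c unfolding eq by simp
qed

lemma lebesgue_integral_affine:
  fixes t :: "'a::euclidean_space" and f :: "'a \<Rightarrow> 'b::{banach, second_countable_topology}"
  assumes c: "c \<noteq> 0" and f: "f \<in> borel_measurable lebesgue"
  shows "(LINT x|lebesgue. f x) = \<bar>c\<bar> ^ DIM('a) *\<^sub>R (LINT x|lebesgue. f (t + c *\<^sub>R x))"
proof -
  have m: "(\<lambda>x. t + c *\<^sub>R x) \<in> lebesgue \<rightarrow>\<^sub>M lebesgue" by (rule measurable_lebesgue_affine[OF c])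
  have "(LINT x|lebesgue. f x)
      = integral\<^sup>L (density (distr lebesgue lebesgue (\<lambda>x. t + c *\<^sub>R x)) (\<lambda>_. ennreal (\<bar>c\<bar> ^ DIM('a)))) f"
    using lebesgue_eq_density_affine[OF c, of t] by simp
  also have "\<dots> = (LINT x|distr lebesgue lebesgue (\<lambda>x. t + c *\<^sub>R x). \<bar>c\<bar> ^ DIM('a) *\<^sub>R f x)"
    using f by (intro integral_density) auto
  also have "\<dots> = (LINT x|lebesgue. \<bar>c\<bar> ^ DIM('a) *\<^sub>R f (t + c *\<^sub>R x))"
    using f m by (intro integral_distr) auto
  finally show ?thesis by simp
qed

lemma lebesgue_integral_translate:
  fixes t :: "'a::euclidean_space" and f :: "'a \<Rightarrow> 'b::{banach, second_countable_topology}"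
  shows "f \<in> borel_measurable lebesgue \<Longrightarrow> (LINT x|lebesgue. f (t + x)) = (LINT x|lebesgue. f x)"
  using lebesgue_integral_affine[of 1 f t] by simp

lemma powr_le_exp: "x \<ge> 0 \<Longrightarrow> a \<ge> 0 \<Longrightarrow> x powr a \<le> exp (a * x)" for x a :: real
  using ln_bound[of x] by (auto simp: powr_def mult_left_mono)

text \<open>With \<open>v\<close> a coordinate axis this is one summand of \<open>Phi a\<close>,
  shifted by the coordinate \<open>c\<close> of a centre.\<close>

lemma exp_growth_abs_powr:
  fixes v :: "'a::euclidean_space"
  assumes a: "a \<ge> 0"
  shows "exp_growth (\<lambda>u. \<bar>c + v \<bullet> u\<bar> powr a)"
  unfolding exp_growth_def
proof (intro conjI)
  have "\<bar>c + v \<bullet> u\<bar> powr a \<le> exp (a * \<bar>c\<bar>) * exp ((a * norm v) * norm u)" for u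
  proof -
    have "\<bar>c + v \<bullet> u\<bar> \<le> \<bar>c\<bar> + norm v * norm u"
      using Cauchy_Schwarz_ineq2[of v u] by linarith
    then have "a * \<bar>c + v \<bullet> u\<bar> \<le> a * \<bar>c\<bar> + (a * norm v) * norm u"
      using mult_left_mono[OF _ a] by (fastforce simp: algebra_simps)
    then have "exp (a * \<bar>c + v \<bullet> u\<bar>) \<le> exp (a * \<bar>c\<bar>) * exp ((a * norm v) * norm u)"
      by (simp flip: exp_add)
    then show ?thesis
      using powr_le_exp[OF abs_ge_zero a, of "c + v \<bullet> u"] by linarith
  qed
  then show "\<exists>C k. \<forall>u. norm (\<bar>c + v \<bullet> u\<bar> powr a) \<le> C * exp (k * norm u)"
    by (intro exI[of _ "exp (a * \<bar>c\<bar>)"] exI[of _ "a * norm v"]) simp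
  have "(\<lambda>u. c + v \<bullet> u) \<in> borel_measurable lebesgue"
    by (intro borel_measurable_lebesgue_continuous continuous_intros)
  then show "(\<lambda>u. \<bar>c + v \<bullet> u\<bar> powr a) \<in> borel_measurable lebesgue" by measurable
qed

section \<open>Convexity of the powers and monotonicity of their symmetrization\<close>

lemma abs_powr_convex:
  fixes x y l a :: real
  assumes a: "a \<ge> 1" and l: "0 \<le> l" "l \<le> 1"
  shows "\<bar>l * x + (1 - l) * y\<bar> powr a \<le> l * \<bar>x\<bar> powr a + (1 - l) * \<bar>y\<bar> powr a"
proof -
  have le: "m powr a \<le> m" if "0 \<le> m" "m \<le> 1" for m :: real
    using powr_mono'[of 1 a m] that a by (cases "m = 0") auto
  have "\<bar>l * x + (1 - l) * y\<bar> \<le> l * \<bar>x\<bar> + (1 - l) * \<bar>y\<bar>"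
    using abs_triangle_ineq[of "l * x" "(1 - l) * y"] l by (simp add: abs_mult)
  then have "\<bar>l * x + (1 - l) * y\<bar> powr a \<le> (l * \<bar>x\<bar> + (1 - l) * \<bar>y\<bar>) powr a"
    using a by (intro powr_mono2) auto
  also have "\<dots> \<le> l * \<bar>x\<bar> powr a + (1 - l) * \<bar>y\<bar> powr a"
  \<comment> \<open>If one argument vanishes, homogeneity reduces the claim to m^a <= m on [0,1],
    applied to the weight of the other argument.\<close>
  proof (cases "x = 0 \<or> y = 0")
    case True
    then show ?thesis
      using le[OF l] le[of "1 - l"] l a by (auto simp: powr_mult intro!: mult_right_mono)
  next
    case False
    then show ?thesis
      using convex_onD[OF powr_convex[OF a], of "1 - l" "\<bar>x\<bar>" "\<bar>y\<bar>"] l by simp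
  qed
  finally show ?thesis .
qed

text \<open>Both c + s' and c - s' are convex combinations of c + s and c - s, with the weights
  \<open>l\<close> and \<open>1 - l\<close> interchanged; adding the two convexity inequalities
  makes the weights sum to one.\<close>

lemma abs_powr_symmetrized_mono:
  fixes c s s' a :: real
  assumes a: "a \<ge> 1" and s: "\<bar>s'\<bar> \<le> \<bar>s\<bar>"
  shows "\<bar>c + s'\<bar> powr a + \<bar>c - s'\<bar> powr a \<le> \<bar>c + s\<bar> powr a + \<bar>c - s\<bar> powr a"
proof (cases "s = 0")
  case False
  define l where "l = (1 + s' / s) / 2"
  have "\<bar>s' / s\<bar> \<le> 1" using s False by (simp add: abs_divide)
  then have "- 1 \<le> s' / s" "s' / s \<le> 1" unfolding abs_le_iff by linarith+
  then have l: "0 \<le> l" "l \<le> 1" by (auto simp: l_def)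
  have e: "l * (c + s) + (1 - l) * (c - s) = c + s'" "l * (c - s) + (1 - l) * (c + s) = c - s'"
    using False by (auto simp: l_def field_simps)
  show ?thesis
    using abs_powr_convex[OF a l, of "c + s" "c - s"] abs_powr_convex[OF a l, of "c - s" "c + s"]
    unfolding e by (simp add: algebra_simps)
qed (use s in simp)

lemma measurable_gauss_laplace_integrand:
  assumes g: "exp_growth g"
  shows "(\<lambda>u. exp (phase z u) *\<^sub>R g u) \<in> borel_measurable lebesgue"
  using g by measurable

lemma gauss_laplace_diff:
  assumes "snd z > 0" "exp_growth g" "exp_growth h"
  shows "gauss_laplace (\<lambda>u. g u - h u) z = gauss_laplace g z - gauss_laplace h z"
  using assms by (simp add: gauss_laplace_def scaleR_diff_right integrable_gauss_laplace)

lemma gauss_laplace_mult_const: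
  fixes g :: "'a::euclidean_space \<Rightarrow> real"
  shows "gauss_laplace (\<lambda>u. c * g u) z = c * gauss_laplace g z"
  using gauss_laplace_scaleR[of c g z] by simp

lemma exp_growth_diff:
  fixes g h :: "'a::euclidean_space \<Rightarrow> real"
  shows "exp_growth g \<Longrightarrow> exp_growth h \<Longrightarrow> exp_growth (\<lambda>u. g u - h u)"
  using exp_growth_add[of g "\<lambda>u. (- 1) * h u"] exp_growth_mult[of "\<lambda>_. - 1" h] by simp

text \<open>Translating by $\tau v$ shows that
  $\int e^{-|w - \tau v|^2/4} (p\cdot w)\, g(w)\,dw$ is affine in $\tau$; compare derivatives at $\tau = 0$.
  This replaces a Fubini argument in the directions on which $g$ does not depend.\<close>

lemma gaussian_moment_invariant_direction:
  fixes g :: "'a::euclidean_space \<Rightarrow> real"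
  assumes g: "exp_growth g" and inv: "\<And>w \<tau>. g (w + \<tau> *\<^sub>R v) = g w"
  shows "gauss_laplace (\<lambda>w. ((v \<bullet> w) * (p \<bullet> w) / 2 - p \<bullet> v) * g w) (0, 1/4) = 0"
proof -
  \<comment> \<open>The value 1/4 is the coordinate s = 1/(4t) at time t = 1, to which everything is
    rescaled.\<close>
  define G1 where "G1 = gauss_laplace g (0, 1/4)"
  define pg where "pg w = (p \<bullet> w) * g w" for w
  define G0 where "G0 = gauss_laplace pg (0, 1/4)"
  have pg: "exp_growth pg" unfolding pg_def[abs_def] using g by (intro exp_growth_mult) auto
  have vpg: "exp_growth (\<lambda>w. (v \<bullet> w) * pg w)" using pg by (intro exp_growth_mult) auto
  \<comment> \<open>The parameter \<open>(\<tau> / 2) *\<^sub>R v\<close> moves the centre of the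
    Gaussian to \<open>\<tau> *\<^sub>R v\<close>, up to the exponential factor on the right, whose
    derivative at 0 vanishes. Translating back leaves \<open>g\<close> unchanged and shifts only the
    linear factor.\<close>
  have J: "gauss_laplace pg ((\<tau> / 2) *\<^sub>R v, 1/4) = exp (\<tau>\<^sup>2 * (norm v)\<^sup>2 / 4) * (G0 + \<tau> * (p \<bullet> v) * G1)" for \<tau>
  proof -
    have ph: "phase ((\<tau> / 2) *\<^sub>R v, 1/4) (\<tau> *\<^sub>R v + w) = \<tau>\<^sup>2 * (norm v)\<^sup>2 / 4 + phase (0, 1/4) w" for w
      unfolding phase_def power2_norm_eq_inner
      by (simp add: inner_simps power2_eq_square inner_commute algebra_simps)
    have pge: "pg (\<tau> *\<^sub>R v + w) = pg w + \<tau> * (p \<bullet> v) * g w" for w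
      using inv[of w \<tau>] by (simp add: pg_def inner_simps algebra_simps)
    have "gauss_laplace pg ((\<tau> / 2) *\<^sub>R v, 1/4)
      = (LINT w|lebesgue. exp (phase ((\<tau> / 2) *\<^sub>R v, 1/4) (\<tau> *\<^sub>R v + w)) *\<^sub>R pg (\<tau> *\<^sub>R v + w))"
      unfolding gauss_laplace_def
      by (rule lebesgue_integral_translate[symmetric]) (rule measurable_gauss_laplace_integrand[OF pg])
    also have "\<dots> = (LINT w|lebesgue. exp (\<tau>\<^sup>2 * (norm v)\<^sup>2 / 4) *
        (exp (phase (0, 1/4) w) *\<^sub>R (pg w + \<tau> * (p \<bullet> v) * g w)))"
      unfolding ph pge by (simp add: exp_add mult.assoc)
    also have "\<dots> = exp (\<tau>\<^sup>2 * (norm v)\<^sup>2 / 4) * gauss_laplace (\<lambda>w. pg w + \<tau> * (p \<bullet> v) * g w) (0, 1/4)"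
      unfolding gauss_laplace_def by (rule integral_mult_right_zero)
    also have "gauss_laplace (\<lambda>w. pg w + \<tau> * (p \<bullet> v) * g w) (0, 1/4) = G0 + \<tau> * (p \<bullet> v) * G1"
      using pg g by (simp add: gauss_laplace_add exp_growth_mult gauss_laplace_mult_const G0_def G1_def)
    finally show ?thesis .
  qed
  have "((\<lambda>\<tau>. exp (\<tau>\<^sup>2 * (norm v)\<^sup>2 / 4) * (G0 + \<tau> * (p \<bullet> v) * G1)) has_real_derivative (p \<bullet> v) * G1) (at 0)"
    by (auto intro!: derivative_eq_intros)
  then have D1: "((\<lambda>\<tau>. gauss_laplace pg ((\<tau> / 2) *\<^sub>R v, 1/4)) has_real_derivative (p \<bullet> v) * G1) (at 0)"
    by (simp add: J)
  have 1: "((\<lambda>\<tau>::real. ((\<tau> / 2) *\<^sub>R v, 1/4::real)) has_derivative (\<lambda>\<tau>. ((\<tau> / 2) *\<^sub>R v, 0))) (at 0)"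
    by (auto intro!: derivative_eq_intros)
  \<comment> \<open>The base point is written as the image of \<open>\<tau> = 0\<close> so that it
    fits the chain rule.\<close>
  have 2: "(gauss_laplace pg has_derivative (\<lambda>h. gauss_laplace (\<lambda>u. phase h u *\<^sub>R pg u) (0, 1/4))) (at ((0 / 2) *\<^sub>R v, 1/4))"
    using has_derivative_gauss_laplace[OF _ pg, of "(0, 1/4)"] by simp
  have "((\<lambda>\<tau>. gauss_laplace pg ((\<tau> / 2) *\<^sub>R v, 1/4)) has_derivative
      (\<lambda>\<tau>. gauss_laplace (\<lambda>u. phase ((\<tau> / 2) *\<^sub>R v, 0) u *\<^sub>R pg u) (0, 1/4))) (at 0)"
    using has_derivative_compose[OF 1 2] by simp
  moreover have "gauss_laplace (\<lambda>u. phase ((\<tau> / 2) *\<^sub>R v, 0) u *\<^sub>R pg u) (0, 1/4)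
      = gauss_laplace (\<lambda>u. (v \<bullet> u) * pg u) (0, 1/4) / 2 * \<tau>" for \<tau>
    using gauss_laplace_mult_const[of "\<tau> / 2" "\<lambda>u. (v \<bullet> u) * pg u" "(0, 1/4)"]
    by (simp add: phase_def algebra_simps)
  then have "(\<lambda>\<tau>. gauss_laplace (\<lambda>u. phase ((\<tau> / 2) *\<^sub>R v, 0) u *\<^sub>R pg u) (0, 1/4))
      = (*) (gauss_laplace (\<lambda>u. (v \<bullet> u) * pg u) (0, 1/4) / 2)" by (intro ext)
  ultimately have "((\<lambda>\<tau>. gauss_laplace pg ((\<tau> / 2) *\<^sub>R v, 1/4)) has_real_derivative
      gauss_laplace (\<lambda>u. (v \<bullet> u) * pg u) (0, 1/4) / 2) (at 0)"
    by (simp only: has_field_derivative_def)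
  then have eq: "gauss_laplace (\<lambda>u. (v \<bullet> u) * pg u) (0, 1/4) / 2 = (p \<bullet> v) * G1"
    using D1 by (rule DERIV_unique)
  have "(\<lambda>w. ((v \<bullet> w) * (p \<bullet> w) / 2 - p \<bullet> v) * g w) = (\<lambda>w. (1/2) * ((v \<bullet> w) * pg w) - (p \<bullet> v) * g w)"
    by (auto simp: pg_def algebra_simps)
  then show ?thesis
    using eq vpg g by (simp add: gauss_laplace_diff exp_growth_mult gauss_laplace_mult_const G1_def del: mult_1_left
        times_divide_eq_left)
qed

text \<open>With $s = e\cdot w$, replace $|c+s|^a$ by its symmetrization $T(s)/2$. Since the weight $s^2/2 - 1$
  has zero Gaussian mean, $T(\sqrt 2)$ may be subtracted from $T(s)$; the weight and $T(s) - T(\sqrt 2)$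
  both change sign at $|s| = \sqrt 2$, so the integrand is nonnegative.\<close>

lemma gaussian_moment_abs_powr_pos:
  fixes e :: "'a::euclidean_space"
  assumes a: "a \<ge> 1" and e: "norm e = 1"
  shows "gauss_laplace (\<lambda>w. ((e \<bullet> w)\<^sup>2 / 2 - 1) * \<bar>c + e \<bullet> w\<bar> powr a) (0, 1/4) > 0"
proof -
  define q where "q w = (e \<bullet> w)\<^sup>2 / 2 - 1" for w
  define T where "T s = \<bar>c + s\<bar> powr a + \<bar>c - s\<bar> powr a" for s
  have gp: "exp_growth (\<lambda>w. \<bar>c + e \<bullet> w\<bar> powr a)" using a by (intro exp_growth_abs_powr) simp
  have gm: "exp_growth (\<lambda>w. \<bar>c - e \<bullet> w\<bar> powr a)"
    using exp_growth_abs_powr[of a c "- e"] a by simp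
  have "exp_growth (\<lambda>w. (1/2) * ((e \<bullet> w) * (e \<bullet> w)) - 1)"
    by (intro exp_growth_diff exp_growth_mult) auto
  then have q: "exp_growth q" by (simp add: q_def[abs_def] power2_eq_square)
  have gT: "exp_growth (\<lambda>w. T (e \<bullet> w))" unfolding T_def using gp gm by (rule exp_growth_add)
  note qp = exp_growth_mult[OF q gp] and qm = exp_growth_mult[OF q gm]
  \<comment> \<open>A constant function is invariant in every direction, so the moment identity
    applies with both directions equal to \<open>e\<close>.\<close>
  have q0: "gauss_laplace q (0, 1/4) = 0"
    using gaussian_moment_invariant_direction[of "\<lambda>_. 1" e e] e
    by (simp add: q_def[abs_def] power2_eq_square dot_square_norm)
  \<comment> \<open>Reflection of \<open>w\<close> at the origin; both the Gaussian and
    \<open>q\<close> are even.\<close>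
  have "gauss_laplace (\<lambda>w. q w * \<bar>c + e \<bullet> w\<bar> powr a) (0, 1/4) = gauss_laplace (\<lambda>w. q w * \<bar>c - e \<bullet> w\<bar> powr a) (0, 1/4)"
    using lebesgue_integral_affine[OF _ measurable_gauss_laplace_integrand[OF qp], of "- 1" "(0, 1/4)" 0]
    unfolding gauss_laplace_def by (simp add: phase_def q_def)
  then have "2 * gauss_laplace (\<lambda>w. q w * \<bar>c + e \<bullet> w\<bar> powr a) (0, 1/4)
    = gauss_laplace (\<lambda>w. q w * \<bar>c + e \<bullet> w\<bar> powr a + q w * \<bar>c - e \<bullet> w\<bar> powr a) (0, 1/4)"
    using qp qm by (simp add: gauss_laplace_add)
  also have "\<dots> = gauss_laplace (\<lambda>w. q w * T (e \<bullet> w)) (0, 1/4) - gauss_laplace (\<lambda>w. T (sqrt 2) * q w) (0, 1/4)"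
    unfolding gauss_laplace_mult_const q0 by (simp add: T_def distrib_left)
  also have "\<dots> = gauss_laplace (\<lambda>w. q w * T (e \<bullet> w) - T (sqrt 2) * q w) (0, 1/4)"
    by (intro gauss_laplace_diff[symmetric] exp_growth_mult q gT) auto
  also have "(\<lambda>w. q w * T (e \<bullet> w) - T (sqrt 2) * q w) = (\<lambda>w. q w * (T (e \<bullet> w) - T (sqrt 2)))"
    by (simp add: algebra_simps)
  also have "gauss_laplace (\<lambda>w. q w * (T (e \<bullet> w) - T (sqrt 2))) (0, 1/4) > 0"
  proof -
    define F where "F w = exp (phase (0, 1/4) w) * (q w * (T (e \<bullet> w) - T (sqrt 2)))" for w
    have "exp_growth (\<lambda>w. q w * (T (e \<bullet> w) - T (sqrt 2)))"
      by (intro exp_growth_mult exp_growth_diff q gT) auto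
    from integrable_gauss_laplace[OF _ this, of "(0, 1/4)"] have F: "integrable lebesgue F"
      by (simp add: F_def[abs_def])
    have nn: "F w \<ge> 0" for w
    proof (cases "(e \<bullet> w)\<^sup>2 \<ge> 2")
      case True
      then have "\<bar>sqrt 2\<bar> \<le> \<bar>e \<bullet> w\<bar>" using real_sqrt_le_iff[of 2 "(e \<bullet> w)\<^sup>2"] by simp
      then have "T (sqrt 2) \<le> T (e \<bullet> w)" unfolding T_def by (rule abs_powr_symmetrized_mono[OF a])
      then show ?thesis using True by (simp add: F_def q_def)
    next
      case False
      then have "\<bar>e \<bullet> w\<bar> \<le> \<bar>sqrt 2\<bar>" using real_sqrt_le_iff[of "(e \<bullet> w)\<^sup>2" 2] by simp
      then have "T (e \<bullet> w) \<le> T (sqrt 2)" unfolding T_def by (rule abs_powr_symmetrized_mono[OF a])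
      then show ?thesis using False by (simp add: F_def q_def mult_nonpos_nonpos)
    qed
    \<comment> \<open>Beyond \<open>K\<close> both factors are strictly positive:
      \<open>\<bar>c + e \<bullet> w\<bar>\<close> exceeds 2 + T(sqrt 2), hence 1, so the power
      \<open>a\<close> cannot decrease it, and \<open>e \<bullet> w\<close> exceeds 2. An integral
      equal to zero would make this open half-space negligible.\<close>
    define K where "K = \<bar>c\<bar> + 2 + T (sqrt 2)"
    have T0: "T (sqrt 2) \<ge> 0" by (simp add: T_def)
    have pos: "F w > 0" if w: "e \<bullet> w > K" for w
    proof -
      have "2 + T (sqrt 2) \<le> \<bar>c + e \<bullet> w\<bar>" using w T0 by (simp add: K_def)
      also have "\<dots> \<le> \<bar>c + e \<bullet> w\<bar> powr a"
        using powr_mono[of 1 a "\<bar>c + e \<bullet> w\<bar>"] a calculation T0 by simp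
      also have "\<dots> \<le> T (e \<bullet> w)" by (simp add: T_def)
      finally have "T (sqrt 2) < T (e \<bullet> w)" by simp
      moreover have "(e \<bullet> w)\<^sup>2 > 2"
      proof -
        have "2 < e \<bullet> w" using w T0 by (simp add: K_def)
        then show ?thesis using power_strict_mono[of 2 "e \<bullet> w" 2] by simp
      qed
      ultimately show ?thesis by (simp add: F_def q_def)
    qed
    have "integral\<^sup>L lebesgue F \<noteq> 0"
    proof
      assume "integral\<^sup>L lebesgue F = 0"
      then have "AE w in lebesgue. F w = 0"
        using integral_nonneg_eq_0_iff_AE[OF F] nn by simp
      then have "AE w in lebesgue. \<not> (e \<bullet> w > K)"
        by eventually_elim (use pos in force)
      moreover have op: "open {w. e \<bullet> w > K}" by (rule open_halfspace_gt)
      ultimately have "negligible {w. e \<bullet> w > K}"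
        unfolding negligible_iff_null_sets by (subst AE_iff_null_sets) auto
      moreover have "(K + 1) *\<^sub>R e \<in> {w. e \<bullet> w > K}" using e by (simp add: dot_square_norm)
      ultimately show False using open_not_negligible op by blast
    qed
    moreover have "integral\<^sup>L lebesgue F \<ge> 0" using nn by simp
    ultimately show ?thesis unfolding gauss_laplace_def F_def[abs_def] by simp
  qed
  finally show ?thesis by (simp add: q_def)
qed

text \<open>Up to a positive factor, $v\cdot\nabla^2 (P_1 g)(\xi)\, v$.\<close>

definition gauss_form :: "('a::euclidean_space \<Rightarrow> real) \<Rightarrow> 'a \<Rightarrow> 'a \<Rightarrow> real" where
  "gauss_form g \<xi> v =
     (LINT u|lebesgue. exp (- (norm (u - \<xi>))\<^sup>2 / 4) * (((v \<bullet> (u - \<xi>))\<^sup>2 / 2 - (norm v)\<^sup>2) * g u))"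

lemma exp_growth_quadratic: "exp_growth (\<lambda>w. (v \<bullet> w)\<^sup>2 / 2 - c)"
proof -
  have "exp_growth (\<lambda>w. (1/2) * ((v \<bullet> w) * (v \<bullet> w)) - c)"
    by (intro exp_growth_diff exp_growth_mult) auto
  then show ?thesis by (simp add: power2_eq_square)
qed

lemma exp_growth_sum:
  assumes "finite I" "\<And>i. i \<in> I \<Longrightarrow> exp_growth (g i)"
  shows "exp_growth (\<lambda>u. \<Sum>i\<in>I. g i u)"
  using assms by (induction I rule: finite_induct) (auto intro: exp_growth_add)

lemma gauss_laplace_sum:
  assumes "finite I" "snd z > 0" "\<And>i. i \<in> I \<Longrightarrow> exp_growth (g i)"
  shows "gauss_laplace (\<lambda>u. \<Sum>i\<in>I. g i u) z = (\<Sum>i\<in>I. gauss_laplace (g i) z)"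
  unfolding gauss_laplace_def scaleR_sum_right
  by (intro Bochner_Integration.integral_sum integrable_gauss_laplace assms)

lemma inner_axis_1 [simp]: "axis k (1::real) \<bullet> w = w $ k"
  by (simp add: inner_axis')

lemma Phi_exp_growth:
  fixes \<xi> :: "real ^ 'n"
  assumes "a \<ge> 0"
  shows "exp_growth (\<lambda>w. Phi a (\<xi> + w))"
proof -
  have "exp_growth (\<lambda>w::real ^ 'n. \<Sum>k\<in>UNIV. \<bar>\<xi> $ k + axis k 1 \<bullet> w\<bar> powr a)"
    using assms by (intro exp_growth_sum exp_growth_abs_powr) auto
  then show ?thesis by (simp add: Phi_def)
qed

text \<open>The k-th summand of \<open>Phi a\<close> depends on one coordinate only, so every part
  of the quadratic weight that involves a direction orthogonal to that axis integrates to zero. What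
  remains is the sum of (v_k)^2 times positive one-coordinate moments.\<close>

lemma gauss_form_Phi_pos:
  fixes v :: "real ^ 'n"
  assumes a: "a \<ge> 1" and v: "v \<noteq> 0"
  shows "gauss_form (Phi a) \<xi> v > 0"
proof -
  define g where "g k w = \<bar>\<xi> $ k + axis k 1 \<bullet> w\<bar> powr a" for k and w :: "real ^ 'n"
  define q where "q w = (v \<bullet> w)\<^sup>2 / 2 - (norm v)\<^sup>2" for w
  have g: "exp_growth (g k)" for k
    unfolding g_def[abs_def] using a by (intro exp_growth_abs_powr) simp
  have q: "exp_growth q" unfolding q_def[abs_def] by (rule exp_growth_quadratic)
  have Phi: "Phi a (\<xi> + w) = (\<Sum>k\<in>UNIV. g k w)" for w
    by (simp add: Phi_def g_def)
  define h where "h k = gauss_laplace (\<lambda>w. ((axis k 1 \<bullet> w)\<^sup>2 / 2 - 1) * g k w) (0, 1/4)" for k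
  have h: "h k > 0" for k
    unfolding h_def g_def by (rule gaussian_moment_abs_powr_pos[OF a]) simp
  have Q: "gauss_laplace (\<lambda>w. q w * g k w) (0, 1/4) = (v $ k)\<^sup>2 * h k" for k
  proof -
    define e where "e = (axis k 1 :: real ^ 'n)"
    \<comment> \<open>Difference of squares: (v' . w)(p . w) = (v . w)^2 - v_k^2 (e . w)^2 and p .
      v' = |v|^2 - v_k^2. Thus \<open>q\<close> splits into a term carrying the invariant direction
      \<open>v'\<close> and v_k^2 times the one-coordinate weight.\<close>
    define v' where "v' = v - (v $ k) *\<^sub>R e"
    define p where "p = v + (v $ k) *\<^sub>R e"
    have ee: "e \<bullet> e = 1" "e \<bullet> w = w $ k" "w \<bullet> e = w $ k" for w
      by (auto simp: e_def inner_axis inner_axis')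
    have "e $ k = 1" by (simp add: e_def)
    have ev: "e \<bullet> v' = 0" by (simp add: v'_def inner_simps ee \<open>e $ k = 1\<close>)
    have inv: "g k (w + \<tau> *\<^sub>R v') = g k w" for w \<tau>
      using ev by (simp add: g_def inner_add_right flip: e_def)
    have qe: "q w = ((v' \<bullet> w) * (p \<bullet> w) / 2 - p \<bullet> v') + (v $ k)\<^sup>2 * ((e \<bullet> w)\<^sup>2 / 2 - 1)" for w
      unfolding q_def v'_def p_def power2_norm_eq_inner
      by (simp add: inner_simps ee \<open>e $ k = 1\<close> power2_eq_square field_simps)
    have eq: "(\<lambda>w. q w * g k w) = (\<lambda>w. ((v' \<bullet> w) * (p \<bullet> w) / 2 - p \<bullet> v') * g k w
        + (v $ k)\<^sup>2 * (((e \<bullet> w)\<^sup>2 / 2 - 1) * g k w))"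
      unfolding qe by (intro ext) (simp only: distrib_right mult.assoc)
    have 1: "exp_growth (\<lambda>w. ((v' \<bullet> w) * (p \<bullet> w) / 2 - p \<bullet> v') * g k w)"
    proof -
      have "exp_growth (\<lambda>w. ((1/2) * ((v' \<bullet> w) * (p \<bullet> w)) - p \<bullet> v') * g k w)"
        by (intro exp_growth_mult exp_growth_diff g) auto
      then show ?thesis by simp
    qed
    have 2: "exp_growth (\<lambda>w. (v $ k)\<^sup>2 * (((e \<bullet> w)\<^sup>2 / 2 - 1) * g k w))"
      by (intro exp_growth_mult exp_growth_quadratic g exp_growth_const)
    show ?thesis
      unfolding eq using gauss_laplace_add[OF _ 1 2, of "(0, 1/4)"]
        gaussian_moment_invariant_direction[OF g inv, of p]
      by (simp add: gauss_laplace_mult_const h_def e_def del: inner_axis_1)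
  qed
  have m: "(\<lambda>u. exp (- (norm (u - \<xi>))\<^sup>2 / 4) * (((v \<bullet> (u - \<xi>))\<^sup>2 / 2 - (norm v)\<^sup>2) * Phi a u)) \<in> borel_measurable lebesgue"
  proof -
    have "Phi a \<in> borel_measurable lebesgue"
      using exp_growth_measurable[OF Phi_exp_growth[of a 0]] a by simp
    moreover have "(\<lambda>u. exp (- (norm (u - \<xi>))\<^sup>2 / 4) * ((v \<bullet> (u - \<xi>))\<^sup>2 / 2 - (norm v)\<^sup>2)) \<in> borel_measurable lebesgue"
      by (intro borel_measurable_lebesgue_continuous continuous_intros) auto
    ultimately show ?thesis
      by (auto simp flip: mult.assoc intro: borel_measurable_times)
  qed
  have "gauss_form (Phi a) \<xi> v = gauss_laplace (\<lambda>w. q w * Phi a (\<xi> + w)) (0, 1/4)"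
    unfolding gauss_form_def gauss_laplace_def
    by (subst lebesgue_integral_translate[OF m, of \<xi>, symmetric]) (simp add: phase_def q_def)
  also have "\<dots> = (\<Sum>k\<in>UNIV. (v $ k)\<^sup>2 * h k)"
    unfolding Phi sum_distrib_left Q[symmetric]
    by (intro gauss_laplace_sum exp_growth_mult q g) auto
  also have "\<dots> > 0"
  proof -
    obtain k where "v $ k \<noteq> 0" using v by (auto simp: vec_eq_iff)
    then show ?thesis using h
      by (intro sum_pos2[of _ k]) (auto intro!: mult_pos_pos mult_nonneg_nonneg less_imp_le[OF h])
  qed
  finally show ?thesis .
qed

section \<open>The small-time limit at the minimizers\<close>

lemma measurable_lebesgue_scaleR:
  fixes f :: "'a::euclidean_space \<Rightarrow> 'b::topological_space"
  assumes f: "f \<in> borel_measurable lebesgue" and c: "c \<noteq> 0"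
  shows "(\<lambda>u. f (c *\<^sub>R u)) \<in> borel_measurable lebesgue"
  using measurable_compose[OF measurable_lebesgue_affine[OF c, of 0] f] by simp

lemma exp_growth_bound:
  assumes "exp_growth B" "\<And>u. norm (g u) \<le> B u" "g \<in> borel_measurable lebesgue"
  shows "exp_growth g"
proof -
  obtain C k where "\<And>u. norm (B u) \<le> C * exp (k * norm u)" using exp_growthE[OF assms(1)] by metis
  then have "norm (g u) \<le> C * exp (k * norm u)" for u
    using assms(2)[of u] by (smt (verit) real_norm_def)
  then show ?thesis using assms(3) by (auto simp: exp_growth_def)
qed

lemma exp_growth_scaled_argument:
  assumes g: "exp_growth g" and c: "c \<noteq> 0"
  shows "exp_growth (\<lambda>u. g (c *\<^sub>R u))"
proof -
  obtain C k where "\<And>u. norm (g u) \<le> C * exp (k * norm u)" using exp_growthE[OF g] by metis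
  then have "norm (g (c *\<^sub>R u)) \<le> C * exp ((k * \<bar>c\<bar>) * norm u)" for u
    by (metis mult.assoc norm_scaleR)
  then show ?thesis
    using measurable_lebesgue_scaleR[OF exp_growth_measurable[OF g] c] by (auto simp: exp_growth_def)
qed

lemma exp_growth_norm_powr:
  assumes "m \<ge> 0" shows "exp_growth (\<lambda>u. norm u powr m)"
  unfolding exp_growth_def
proof (intro conjI)
  show "\<exists>C k. \<forall>u. norm (norm u powr m) \<le> C * exp (k * norm u)"
    using powr_le_exp[OF norm_ge_zero assms] by (intro exI[of _ 1] exI[of _ m]) auto
  show "(\<lambda>u. norm u powr m) \<in> borel_measurable lebesgue"
    using exp_growth_measurable[OF exp_growth_norm] by measurable
qed

lemma gaussian_eq_phase:
  "exp (- (norm (u - \<xi>))\<^sup>2 / 4) = exp (- (norm \<xi>)\<^sup>2 / 4) * exp (phase ((1/2) *\<^sub>R \<xi>, 1/4) u)"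
  unfolding phase_def power2_norm_eq_inner exp_add[symmetric]
  by (simp add: inner_simps inner_commute field_simps)

lemma integrable_gaussian_shifted:
  fixes g :: "'a::euclidean_space \<Rightarrow> real"
  assumes g: "exp_growth g"
  shows "integrable lebesgue (\<lambda>u. exp (- (norm (u - \<xi>))\<^sup>2 / 4) * g u)"
  using integrable_mult_right[OF integrable_gauss_laplace[OF _ g, of "((1/2) *\<^sub>R \<xi>, 1/4)"], of "exp (- (norm \<xi>)\<^sup>2 / 4)"]
  unfolding gaussian_eq_phase by (simp add: mult.assoc)

text \<open>Dominated convergence, jointly in the profile, the centre and the direction. Since the
  form contains no derivative of the profile, pointwise convergence is enough.\<close>

lemma gauss_form_tendsto:
  fixes h :: "nat \<Rightarrow> 'a::euclidean_space \<Rightarrow> real"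
  assumes h: "\<And>k. h k \<in> borel_measurable lebesgue" and h0: "h0 \<in> borel_measurable lebesgue"
    and B: "exp_growth B" "\<And>k u. \<bar>h k u\<bar> \<le> B u"
    and lim: "\<And>u. (\<lambda>k. h k u) \<longlonglongrightarrow> h0 u"
    and \<xi>: "\<xi> \<longlonglongrightarrow> \<xi>0" and v: "v \<longlonglongrightarrow> v0"
  shows "(\<lambda>k. gauss_form (h k) (\<xi> k) (v k)) \<longlonglongrightarrow> gauss_form h0 \<xi>0 v0"
proof -
  obtain M where M: "\<And>k. norm (\<xi> k) \<le> M"
    using convergent_imp_Bseq[of \<xi>] \<xi> by (auto simp: convergent_def Bseq_def)
  obtain V where V: "\<And>k. norm (v k) \<le> V"
    using convergent_imp_Bseq[of v] v by (auto simp: convergent_def Bseq_def)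
  have MV: "M \<ge> 0" "V \<ge> 0" using M[of 0] V[of 0] norm_ge_zero order_trans by blast+
  \<comment> \<open>Cauchy-Schwarz bound for the quadratic weight, uniform over centres of norm at
    most \<open>M\<close> and directions of norm at most \<open>V\<close>.\<close>
  define P where "P u = (V * (norm u + M)) * (V * (norm u + M)) + V\<^sup>2" for u :: 'a
  have P: "exp_growth P" unfolding P_def by (intro exp_growth_add exp_growth_mult) auto
  define W where "W u = exp (M / 2 * norm u - 1/4 * (norm u)\<^sup>2) *\<^sub>R (P u * B u)" for u
  have W: "integrable lebesgue W"
    unfolding W_def[abs_def] by (intro integrable_gaussian_exp_growth exp_growth_mult P B) auto
  have meas: "(\<lambda>u. exp (- (norm (u - \<xi>))\<^sup>2 / 4) * (((v \<bullet> (u - \<xi>))\<^sup>2 / 2 - (norm v)\<^sup>2) * g u)) \<in> borel_measurable lebesgue"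
    if g: "g \<in> borel_measurable lebesgue" for g :: "'a \<Rightarrow> real" and \<xi> v
  proof -
    have "(\<lambda>u. exp (- (norm (u - \<xi>))\<^sup>2 / 4) * ((v \<bullet> (u - \<xi>))\<^sup>2 / 2 - (norm v)\<^sup>2)) \<in> borel_measurable lebesgue"
      by (intro borel_measurable_lebesgue_continuous continuous_intros) auto
    then show ?thesis using g by (auto simp flip: mult.assoc intro: borel_measurable_times)
  qed
  show ?thesis
    unfolding gauss_form_def
  proof (rule integral_dominated_convergence[where w = W])
    show "AE u in lebesgue. (\<lambda>k. exp (- (norm (u - \<xi> k))\<^sup>2 / 4) * (((v k \<bullet> (u - \<xi> k))\<^sup>2 / 2 - (norm (v k))\<^sup>2) * h k u))
      \<longlonglongrightarrow> exp (- (norm (u - \<xi>0))\<^sup>2 / 4) * (((v0 \<bullet> (u - \<xi>0))\<^sup>2 / 2 - (norm v0)\<^sup>2) * h0 u)"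
      by (intro AE_I2 tendsto_intros lim \<xi> v) auto
    show "AE u in lebesgue. norm (exp (- (norm (u - \<xi> k))\<^sup>2 / 4) * (((v k \<bullet> (u - \<xi> k))\<^sup>2 / 2 - (norm (v k))\<^sup>2) * h k u)) \<le> W u" for k
    proof (rule AE_I2)
      fix u :: 'a
      \<comment> \<open>Expand the square and drop the nonpositive contribution of the squared norm
        of the centre.\<close>
      have "- (norm (u - \<xi> k))\<^sup>2 / 4 \<le> M / 2 * norm u - 1/4 * (norm u)\<^sup>2"
      proof -
        have "u \<bullet> \<xi> k \<le> M * norm u"
          unfolding mult.commute[of M] using norm_cauchy_schwarz[of u "\<xi> k"] mult_left_mono[OF M[of k] norm_ge_zero[of u]] by linarith
        moreover have "(norm (u - \<xi> k))\<^sup>2 = (norm u)\<^sup>2 - 2 * (u \<bullet> \<xi> k) + (norm (\<xi> k))\<^sup>2"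
          unfolding power2_norm_eq_inner by (simp add: inner_simps inner_commute)
        moreover have "0 \<le> (norm (\<xi> k))\<^sup>2" by simp
        ultimately show ?thesis by linarith
      qed
      then have 1: "exp (- (norm (u - \<xi> k))\<^sup>2 / 4) \<le> exp (M / 2 * norm u - 1/4 * (norm u)\<^sup>2)" by simp
      have 2: "\<bar>(v k \<bullet> (u - \<xi> k))\<^sup>2 / 2 - (norm (v k))\<^sup>2\<bar> \<le> P u"
      proof -
        have "\<bar>v k \<bullet> (u - \<xi> k)\<bar> \<le> norm (v k) * norm (u - \<xi> k)" by (rule Cauchy_Schwarz_ineq2)
        also have "\<dots> \<le> V * (norm u + M)"
          using V[of k] M[of k] MV norm_triangle_ineq4[of u "\<xi> k"] by (intro mult_mono) auto
        finally have "(v k \<bullet> (u - \<xi> k))\<^sup>2 \<le> (V * (norm u + M))\<^sup>2"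
          by (rule power2_le_iff_abs_le[THEN iffD2, rotated]) (use MV in auto)
        moreover have "(norm (v k))\<^sup>2 \<le> V\<^sup>2" using V[of k] by (intro power_mono) auto
        moreover have "0 \<le> (v k \<bullet> (u - \<xi> k))\<^sup>2" "0 \<le> (norm (v k))\<^sup>2" "0 \<le> V\<^sup>2" by auto
        ultimately show ?thesis
          unfolding P_def power2_eq_square[symmetric] abs_le_iff by linarith
      qed
      have "norm (exp (- (norm (u - \<xi> k))\<^sup>2 / 4) * (((v k \<bullet> (u - \<xi> k))\<^sup>2 / 2 - (norm (v k))\<^sup>2) * h k u))
         = exp (- (norm (u - \<xi> k))\<^sup>2 / 4) * (\<bar>(v k \<bullet> (u - \<xi> k))\<^sup>2 / 2 - (norm (v k))\<^sup>2\<bar> * \<bar>h k u\<bar>)"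
        by (simp add: abs_mult)
      also have "\<dots> \<le> exp (M / 2 * norm u - 1/4 * (norm u)\<^sup>2) * (P u * B u)"
        using 2 by (intro mult_mono 1 B(2)) auto
      finally show "norm (exp (- (norm (u - \<xi> k))\<^sup>2 / 4) * (((v k \<bullet> (u - \<xi> k))\<^sup>2 / 2 - (norm (v k))\<^sup>2) * h k u)) \<le> W u"
        by (simp add: W_def)
    qed
  qed (intro meas h h0 W)+
qed

lemma gauss_form_scaleR: "gauss_form g \<xi> (c *\<^sub>R v) = c\<^sup>2 * gauss_form g \<xi> v"
proof -
  have "gauss_form g \<xi> (c *\<^sub>R v) = (LINT u|lebesgue. c\<^sup>2 * (exp (- (norm (u - \<xi>))\<^sup>2 / 4) * (((v \<bullet> (u - \<xi>))\<^sup>2 / 2 - (norm v)\<^sup>2) * g u)))"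
    unfolding gauss_form_def by (intro Bochner_Integration.integral_cong) (auto simp: power_mult_distrib field_simps)
  then show ?thesis by (simp add: gauss_form_def)
qed

lemma gauss_form_cmult: "gauss_form (\<lambda>u. c * g u) \<xi> v = c * gauss_form g \<xi> v"
proof -
  have "gauss_form (\<lambda>u. c * g u) \<xi> v = (LINT u|lebesgue. c * (exp (- (norm (u - \<xi>))\<^sup>2 / 4) * (((v \<bullet> (u - \<xi>))\<^sup>2 / 2 - (norm v)\<^sup>2) * g u)))"
    unfolding gauss_form_def by (intro Bochner_Integration.integral_cong) (auto simp: algebra_simps)
  then show ?thesis by (simp add: gauss_form_def)
qed

text \<open>The substitution y = s u at time s^2 gives the kernel a fixed width, so all dependence
  on time moves into the dilated profile and a positive factor.\<close>

lemma heat_reg_rescaled: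
  fixes f :: "real ^ 'n \<Rightarrow> real"
  assumes f: "f \<in> borel_measurable lebesgue" and s: "s > 0"
  shows "heat_reg f (s\<^sup>2) (s *\<^sub>R \<xi>) =
    s ^ CARD('n) / (4 * pi * s\<^sup>2) powr (real CARD('n) / 2) *
    (LINT u|lebesgue. exp (- (norm (u - \<xi>))\<^sup>2 / 4) * f (s *\<^sub>R u))"
proof -
  define c where "c = 1 / (4 * pi * s\<^sup>2) powr (real CARD('n) / 2)"
  have "(\<lambda>y. heat_kernel (s\<^sup>2) (s *\<^sub>R \<xi> - y)) \<in> borel_measurable lebesgue"
    unfolding heat_kernel_def using s
    by (intro borel_measurable_lebesgue_continuous continuous_intros) auto
  then have m: "(\<lambda>y. heat_kernel (s\<^sup>2) (s *\<^sub>R \<xi> - y) * f y) \<in> borel_measurable lebesgue"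
    using f by measurable
  have k: "heat_kernel (s\<^sup>2) (s *\<^sub>R \<xi> - s *\<^sub>R u) = c * exp (- (norm (u - \<xi>))\<^sup>2 / 4)" for u :: "real ^ 'n"
  proof -
    have "norm (s *\<^sub>R \<xi> - s *\<^sub>R u) = s * norm (u - \<xi>)"
      using s by (simp add: norm_minus_commute flip: scaleR_diff_right)
    then show ?thesis using s by (simp add: heat_kernel_def c_def power_mult_distrib)
  qed
  have "heat_reg f (s\<^sup>2) (s *\<^sub>R \<xi>) = s ^ CARD('n) * (LINT u|lebesgue. c * exp (- (norm (u - \<xi>))\<^sup>2 / 4) * f (s *\<^sub>R u))"
    unfolding heat_reg_def using lebesgue_integral_affine[OF _ m, of s 0] s by (simp add: k)
  also have "\<dots> = s ^ CARD('n) * (c * (LINT u|lebesgue. exp (- (norm (u - \<xi>))\<^sup>2 / 4) * f (s *\<^sub>R u)))"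
    by (simp add: mult.assoc)
  finally show ?thesis by (simp add: c_def)
qed

section \<open>Uniform bounds and limit of the rescaled profile\<close>

lemma quadratic_lower_bound_nonneg: "quadratic_lower_bound f \<Longrightarrow> f x \<ge> 0"
  unfolding quadratic_lower_bound_def
  by (meson less_eq_real_def mult_nonneg_nonneg order_trans zero_le_power2)

lemma exp_growth_polynomial_tail:
  assumes f: "f \<in> borel_measurable lebesgue" and q: "quadratic_lower_bound f" and p: "polynomial_tail f"
  shows "exp_growth f"
proof -
  obtain C m where C: "C > 0" "m \<ge> 2" "\<And>x. f x \<le> C * (1 + norm x powr m)"
    using p unfolding polynomial_tail_def by blast
  show ?thesis
  proof (rule exp_growth_bound[OF _ _ f])
    show "exp_growth (\<lambda>x. C * (1 + norm x powr m))"
      using C by (intro exp_growth_mult exp_growth_add exp_growth_norm_powr) auto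
  qed (use C quadratic_lower_bound_nonneg[OF q] in auto)
qed

lemma Phi_scaleR: "s \<ge> 0 \<Longrightarrow> Phi a (s *\<^sub>R u) = s powr a * Phi a u"
  by (simp add: Phi_def abs_mult powr_mult sum_distrib_left)

lemma Phi_nonneg: "Phi a u \<ge> 0"
  by (simp add: Phi_def sum_nonneg)

lemma le_powr_plus_1:
  fixes x a :: real
  assumes "x \<ge> 0" "a \<ge> 1"
  shows "x \<le> x powr a + 1"
proof (cases "x \<ge> 1")
  case False
  then show ?thesis using powr_ge_zero[of x a] by linarith
qed (use assms powr_mono[of 1 a x] in auto)

text \<open>Linear growth is all that coercivity requires; the subtracted dimension pays for the
  coordinates of modulus below one.\<close>

lemma Phi_ge_norm:
  fixes u :: "real ^ 'n"
  assumes "a \<ge> 1" shows "norm u - real CARD('n) \<le> Phi a u"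
proof -
  have "norm u \<le> (\<Sum>i\<in>UNIV. \<bar>u $ i\<bar>)" by (rule norm_le_l1_cart)
  also have "\<dots> \<le> (\<Sum>i\<in>UNIV. \<bar>u $ i\<bar> powr a + 1)"
    using assms by (intro sum_mono le_powr_plus_1) auto
  finally show ?thesis by (simp add: Phi_def sum.distrib)
qed

text \<open>Two regimes. Where \<open>s *\<^sub>R u\<close> lies within \<open>r1\<close>, the
  relative error is at most 1/2 and the homogeneity of \<open>Phi a\<close> cancels the scale;
  outside, the global quadratic and polynomial bounds take over, and s |u| >= r1 converts between
  powers.\<close>

lemma rescaled_profile:
  fixes f :: "real ^ 'n \<Rightarrow> real"
  assumes q: "quadratic_lower_bound f" and l: "leading_order_profile f" and p: "polynomial_tail f"
  obtains a c B where "a \<ge> 1" "c > 0" "exp_growth B"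
    "\<And>s u. 0 < s \<Longrightarrow> s \<le> 1 \<Longrightarrow> c * (norm u - real CARD('n)) \<le> s powr (- a) * f (s *\<^sub>R u)"
    "\<And>s u. 0 < s \<Longrightarrow> s \<le> 1 \<Longrightarrow> s powr (- a) * f (s *\<^sub>R u) \<le> B u"
    "\<And>u. ((\<lambda>s. s powr (- a) * f (s *\<^sub>R u)) \<longlongrightarrow> Phi a u) (at_right 0)"
proof -
  obtain c0 where c0: "c0 > 0" "\<And>x. f x \<ge> c0 * (norm x)\<^sup>2" and f0: "f 0 = 0"
    using q unfolding quadratic_lower_bound_def by blast
  obtain C m where C: "C > 0" "m \<ge> 2" "\<And>x. f x \<le> C * (1 + norm x powr m)"
    using p unfolding polynomial_tail_def by blast
  obtain a r0 r \<omega> where a: "1 \<le> a" "a \<le> 2" and r0: "r0 > 0" and \<omega>: "(\<omega> \<longlongrightarrow> 0) (at_right 0)"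
    and fr: "\<And>x. norm x < r0 \<Longrightarrow> f x = Phi a x + r x \<and> \<bar>r x\<bar> \<le> \<omega> (norm x) * Phi a x"
    using l unfolding leading_order_profile_def by fastforce
  have "\<forall>\<^sub>F \<rho> in at_right 0. \<omega> \<rho> < 1/2" using \<omega> by (rule order_tendstoD) simp
  then obtain r1' where r1': "r1' > 0" "\<And>\<rho>. 0 < \<rho> \<Longrightarrow> \<rho> < r1' \<Longrightarrow> \<omega> \<rho> < 1/2"
    unfolding eventually_at_right_field by auto
  define r1 where "r1 = min r0 r1'"
  have r1: "r1 > 0" using r0 r1' by (simp add: r1_def)
  have near: "1/2 * Phi a x \<le> f x \<and> f x \<le> 3/2 * Phi a x" if x: "norm x < r1" for x
  proof -
    have "\<bar>r x\<bar> \<le> 1/2 * Phi a x"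
    \<comment> \<open>The limit of \<open>\<omega>\<close> from the right says nothing about its
      value at 0, but there \<open>Phi a\<close> vanishes.\<close>
    proof (cases "x = 0")
      case True
      then have "Phi a x = 0" by (simp add: Phi_def)
      then show ?thesis using fr[of x] r0 True by simp
    next
      case False
      then have "\<omega> (norm x) < 1/2" using x by (intro r1') (auto simp: r1_def)
      then have "\<omega> (norm x) * Phi a x \<le> 1/2 * Phi a x" by (intro mult_right_mono Phi_nonneg) auto
      then show ?thesis using fr[of x] x by (simp add: r1_def)
    qed
    moreover have "f x = Phi a x + r x" using fr[of x] x by (simp add: r1_def)
    ultimately show ?thesis by linarith
  qed
  define h where "h s u = s powr (- a) * f (s *\<^sub>R u)" for s u
  have sP: "s powr (- a) * Phi a (s *\<^sub>R u) = Phi a u" if "s > 0" for s and u :: "real ^ 'n"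
    using that by (simp add: Phi_scaleR powr_minus)
  \<comment> \<open>The first entry serves the inner regime, the second the outer one.\<close>
  define c where "c = min (1/2) (c0 * r1 powr (2 - a))"
  have c: "c > 0" using c0 r1 by (simp add: c_def)
  define B where "B u = 3/2 * Phi a u + C * (1 + r1 powr (- m)) * norm u powr m" for u :: "real ^ 'n"
  have "exp_growth (\<lambda>u::real^'n. Phi a u)"
    using Phi_exp_growth[of a 0] a by simp
  then have B: "exp_growth B"
    unfolding B_def[abs_def] using C by (intro exp_growth_add exp_growth_mult exp_growth_norm_powr) auto
  have lower: "c * (norm u - real CARD('n)) \<le> h s u" if s: "0 < s" "s \<le> 1" for s u
  proof (cases "norm u \<ge> real CARD('n)")
    case False
    then have "c * (norm u - real CARD('n)) \<le> 0" using c by (simp add: mult_nonneg_nonpos)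
    moreover have "h s u \<ge> 0" using quadratic_lower_bound_nonneg[OF q] by (simp add: h_def)
    ultimately show ?thesis by simp
  next
    case u: True
    have n1: "real CARD('n) \<ge> 1" by simp
    show ?thesis
    proof (cases "norm (s *\<^sub>R u) < r1")
      case True
      have "c * (norm u - real CARD('n)) \<le> 1/2 * (norm u - real CARD('n))"
        using u by (intro mult_right_mono) (auto simp: c_def)
      also have "\<dots> \<le> 1/2 * Phi a u" using Phi_ge_norm[OF a(1), of u] by simp
      also have "\<dots> = s powr (- a) * (1/2 * Phi a (s *\<^sub>R u))" using sP[OF s(1), of u] by simp
      also have "\<dots> \<le> h s u" unfolding h_def using near[OF True] by (intro mult_left_mono) auto
      finally show ?thesis .
    next
      case False
      then have su: "r1 \<le> s * norm u" using s by simp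
      have u0: "norm u > 0" using u n1 by linarith
      have "c * (norm u - real CARD('n)) \<le> (c0 * r1 powr (2 - a)) * (norm u - real CARD('n))"
        using u by (intro mult_right_mono) (auto simp: c_def)
      \<comment> \<open>Write (s |u|)^2 as (s |u|)^(2-a) s^a |u|^a: the first factor is at least
        r1^(2-a) because a <= 2, and s^a cancels the normalization.\<close>
      also have "\<dots> \<le> (c0 * (s * norm u) powr (2 - a)) * norm u powr a"
      proof (intro mult_mono powr_mono2)
        show "norm u - real CARD('n) \<le> norm u powr a"
          using le_powr_plus_1[OF norm_ge_zero a(1), of u] n1 by linarith
      qed (use c0 a r1 su u in auto)
      also have "\<dots> = s powr (- a) * (c0 * (s * norm u)\<^sup>2)"
        using s u0 by (simp add: powr_mult powr_diff powr_minus field_simps)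
      also have "\<dots> \<le> h s u" unfolding h_def using c0(2)[of "s *\<^sub>R u"] s by (intro mult_left_mono) auto
      finally show ?thesis .
    qed
  qed
  have upper: "h s u \<le> B u" if s: "0 < s" "s \<le> 1" for s u
  proof (cases "norm (s *\<^sub>R u) < r1")
    case True
    have "h s u \<le> s powr (- a) * (3/2 * Phi a (s *\<^sub>R u))"
      unfolding h_def using near[OF True] by (intro mult_left_mono) auto
    also have "\<dots> = 3/2 * Phi a u" using sP[OF s(1), of u] by simp
    also have "\<dots> \<le> B u" using C by (simp add: B_def)
    finally show ?thesis .
  next
    case False
    then have su: "r1 \<le> s * norm u" using s by simp
    then have u0: "norm u > 0" using r1 s by (metis less_le_trans zero_less_mult_pos)
    \<comment> \<open>Absorbs the constant term of the tail bound, so that only a pure power of s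
      |u| is rescaled; this produces the factor 1 + r1^(-m) in \<open>B\<close>.\<close>
    have "1 \<le> r1 powr (- m) * (s * norm u) powr m"
    proof -
      have "r1 powr m \<le> (s * norm u) powr m" using su r1 C by (intro powr_mono2) auto
      then show ?thesis using r1 by (simp add: powr_minus field_simps)
    qed
    then have "f (s *\<^sub>R u) \<le> C * ((1 + r1 powr (- m)) * (s * norm u) powr m)"
      using C(3)[of "s *\<^sub>R u"] C(1) s
      by (intro order_trans[OF C(3)] mult_left_mono) (auto simp: distrib_right)
    then have "h s u \<le> s powr (- a) * (C * ((1 + r1 powr (- m)) * (s * norm u) powr m))"
      unfolding h_def by (intro mult_left_mono) auto
    also have "\<dots> = s powr (m - a) * (C * (1 + r1 powr (- m)) * norm u powr m)"
      using s u0 by (simp add: powr_mult powr_diff powr_minus field_simps)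
    also have "\<dots> \<le> 1 * (C * (1 + r1 powr (- m)) * norm u powr m)"
    proof (intro mult_right_mono)
      \<comment> \<open>Uses a <= 2 <= m together with s <= 1.\<close>
      show "s powr (m - a) \<le> 1" using s a C by (intro powr_le1) auto
    qed (use C in auto)
    also have "\<dots> \<le> B u" using Phi_nonneg[of a u] by (simp add: B_def)
    finally show ?thesis .
  qed
  have lim: "((\<lambda>s. h s u) \<longlongrightarrow> Phi a u) (at_right 0)" for u
  proof (cases "u = 0")
    case True
    then show ?thesis using f0 by (simp add: h_def Phi_def)
  next
    case False
    have 0: "((\<lambda>s. s * norm u) \<longlongrightarrow> 0 * norm u) (at_right 0)" by (intro tendsto_intros)
    moreover have "\<forall>\<^sub>F s in at_right 0. s * norm u > 0"
      using False by (auto simp: eventually_at_right_field intro!: exI[of _ 1])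
    ultimately have "filterlim (\<lambda>s. s * norm u) (at_right 0) (at_right 0)"
      by (auto simp: filterlim_at elim!: eventually_mono)
    from filterlim_compose[OF \<omega> this] have \<omega>0: "((\<lambda>s. \<omega> (s * norm u) * Phi a u) \<longlongrightarrow> 0) (at_right 0)"
      by (auto intro: tendsto_eq_intros)
    have "\<forall>\<^sub>F s in at_right 0. s * norm u < r0" using order_tendstoD(2)[OF 0, of r0] r0 by simp
    moreover have "\<forall>\<^sub>F s in at_right (0::real). s > 0" by (rule eventually_at_right_less)
    \<comment> \<open>By homogeneity the difference is exactly the rescaled remainder
      \<open>r\<close>, and the scale cancels in its bound.\<close>
    ultimately have "\<forall>\<^sub>F s in at_right 0. norm (h s u - Phi a u) \<le> \<omega> (s * norm u) * Phi a u"
    proof eventually_elim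
      case (elim s)
      then have fs: "f (s *\<^sub>R u) = Phi a (s *\<^sub>R u) + r (s *\<^sub>R u)"
        "\<bar>r (s *\<^sub>R u)\<bar> \<le> \<omega> (s * norm u) * Phi a (s *\<^sub>R u)" using fr[of "s *\<^sub>R u"] by auto
      have "h s u - Phi a u = s powr (- a) * r (s *\<^sub>R u)"
        using sP[of s u] elim by (simp add: h_def fs distrib_left)
      then have "norm (h s u - Phi a u) \<le> s powr (- a) * (\<omega> (s * norm u) * Phi a (s *\<^sub>R u))"
        using fs(2) by (simp add: abs_mult mult_left_mono)
      also have "\<dots> = \<omega> (s * norm u) * (s powr (- a) * Phi a (s *\<^sub>R u))" by (simp only: mult_ac)
      also have "\<dots> = \<omega> (s * norm u) * Phi a u" using sP[of s u] elim by simp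
      finally show ?case .
    qed
    then have "((\<lambda>s. h s u - Phi a u) \<longlongrightarrow> 0) (at_right 0)"
      using \<omega>0 by (rule Lim_null_comparison)
    then show ?thesis by (rule LIM_zero_cancel)
  qed
  show ?thesis
    using that[OF a(1) c B] lower upper lim unfolding h_def by blast
qed

section \<open>Coercivity and compactness of the rescaled minimizers\<close>

lemma gauss_mass_pos: "gauss_laplace (\<lambda>_::'a::euclidean_space. 1::real) z > 0" if "snd z > 0"
proof -
  have i: "integrable lebesgue (\<lambda>u::'a. exp (phase z u))"
    using integrable_gauss_laplace[OF that, of "\<lambda>_. 1::real"] by simp
  have "integral\<^sup>L lebesgue (\<lambda>u::'a. exp (phase z u)) \<noteq> 0"
  proof
    assume "integral\<^sup>L lebesgue (\<lambda>u::'a. exp (phase z u)) = 0"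
    then have "AE u::'a in lebesgue. False"
      using integral_nonneg_eq_0_iff_AE[OF i] by simp
    then have "UNIV \<in> null_sets (lebesgue :: 'a measure)"
      by (subst AE_iff_null_sets) auto
    then have "negligible (UNIV :: 'a set)" by (simp add: negligible_iff_null_sets)
    then show False using open_not_negligible[of "UNIV :: 'a set"] by auto
  qed
  moreover have "integral\<^sup>L lebesgue (\<lambda>u::'a. exp (phase z u)) \<ge> 0" by simp
  ultimately have "integral\<^sup>L lebesgue (\<lambda>u::'a. exp (phase z u)) > 0" by linarith
  then show ?thesis by (simp add: gauss_laplace_def)
qed

text \<open>Centre the Gaussian by u = \<xi> + w and average |\<xi> + w| >= |\<xi>| - |w|. The
  resulting growth in |\<xi>| prevents minimizers from escaping to infinity.\<close>

lemma gauss_average_coercive: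
  fixes g :: "'a::euclidean_space \<Rightarrow> real"
  assumes g: "exp_growth g" and c: "c > 0" and lower: "\<And>u. c * (norm u - b) \<le> g u"
  shows "c * (norm \<xi> * gauss_laplace (\<lambda>_::'a. 1) (0, 1/4) - gauss_laplace (\<lambda>w::'a. norm w + b) (0, 1/4))
    \<le> (LINT u|lebesgue. exp (- (norm (u - \<xi>))\<^sup>2 / 4) * g u)"
proof -
  have gr: "exp_growth (\<lambda>w::'a. norm w + b)" by (intro exp_growth_add) auto
  note i = integrable_gaussian_shifted[OF g, of \<xi>]
  have "c * (norm \<xi> * gauss_laplace (\<lambda>_::'a. 1) (0, 1/4) - gauss_laplace (\<lambda>w::'a. norm w + b) (0, 1/4))
    = gauss_laplace (\<lambda>w::'a. c * (norm \<xi> * 1 - (norm w + b))) (0, 1/4)"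
    using gr by (simp add: gauss_laplace_mult_const gauss_laplace_diff
        gauss_laplace_mult_const[of "norm \<xi>" "\<lambda>_. 1", simplified])
  also have "\<dots> \<le> (LINT w|lebesgue. exp (- (norm (\<xi> + w - \<xi>))\<^sup>2 / 4) * g (\<xi> + w))"
    unfolding gauss_laplace_def
  proof (rule integral_mono)
    show "integrable lebesgue (\<lambda>w::'a. exp (phase (0, 1/4) w) *\<^sub>R (c * (norm \<xi> * 1 - (norm w + b))))"
      using gr by (intro integrable_gauss_laplace exp_growth_mult exp_growth_diff) auto
    have "exp_growth (\<lambda>w. g (\<xi> + w))"
    proof -
      obtain C k where C: "C \<ge> 0" "k \<ge> 0" "\<And>u. norm (g u) \<le> C * exp (k * norm u)" using exp_growthE[OF g] by metis
      have "norm (g (\<xi> + w)) \<le> C * exp (k * norm \<xi>) * exp (k * norm w)" for w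
      proof -
        have "k * norm (\<xi> + w) \<le> k * norm \<xi> + k * norm w"
          using mult_left_mono[OF norm_triangle_ineq C(2), of \<xi> w] by (simp add: distrib_left)
        then have "C * exp (k * norm (\<xi> + w)) \<le> C * (exp (k * norm \<xi>) * exp (k * norm w))"
          using C(1) by (intro mult_left_mono) (auto simp flip: exp_add)
        then show ?thesis using C(3)[of "\<xi> + w"] by simp
      qed
      moreover have "(\<lambda>w. g (\<xi> + w)) \<in> borel_measurable lebesgue"
        using measurable_compose[OF measurable_lebesgue_affine[of 1 \<xi>] exp_growth_measurable[OF g]] by simp
      ultimately show ?thesis by (auto simp: exp_growth_def)
    qed
    from integrable_gaussian_shifted[OF this, of 0]
    show "integrable lebesgue (\<lambda>w. exp (- (norm (\<xi> + w - \<xi>))\<^sup>2 / 4) * g (\<xi> + w))" by simp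
    fix w :: 'a
    have "c * (norm \<xi> * 1 - (norm w + b)) \<le> c * (norm (\<xi> + w) - b)"
      using c norm_diff_ineq[of \<xi> w] by (intro mult_left_mono) auto
    also have "\<dots> \<le> g (\<xi> + w)" by (rule lower)
    finally show "exp (phase (0, 1/4) w) *\<^sub>R (c * (norm \<xi> * 1 - (norm w + b))) \<le> exp (- (norm (\<xi> + w - \<xi>))\<^sup>2 / 4) * g (\<xi> + w)"
      by (simp add: phase_def mult_left_mono)
  qed
  also have "\<dots> = (LINT u|lebesgue. exp (- (norm (u - \<xi>))\<^sup>2 / 4) * g u)"
    by (rule lebesgue_integral_translate) (rule borel_measurable_integrable[OF i])
  finally show ?thesis .
qed

lemma minimizer_form_pos:
  fixes f :: "real ^ 'n \<Rightarrow> real" and x :: "real \<Rightarrow> real ^ 'n"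
  assumes f: "f \<in> borel_measurable lebesgue" and q: "quadratic_lower_bound f"
    and l: "leading_order_profile f" and p: "polynomial_tail f"
    and min: "\<And>t. t > 0 \<Longrightarrow> is_arg_min (heat_reg f t) (\<lambda>_. True) (x t)"
  shows "\<exists>t0>0. \<forall>t\<in>{0<..<t0}. \<forall>v. v \<noteq> 0 \<longrightarrow>
    gauss_form (\<lambda>u. f (sqrt t *\<^sub>R u)) (x t /\<^sub>R sqrt t) v > 0"
proof -
  obtain a c B where a: "a \<ge> 1" and c: "c > 0" and B: "exp_growth B"
    and lower: "\<And>s u. 0 < s \<Longrightarrow> s \<le> 1 \<Longrightarrow> c * (norm u - real CARD('n)) \<le> s powr (- a) * f (s *\<^sub>R u)"
    and upper: "\<And>s u. 0 < s \<Longrightarrow> s \<le> 1 \<Longrightarrow> s powr (- a) * f (s *\<^sub>R u) \<le> B u"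
    and lim: "\<And>u. ((\<lambda>s. s powr (- a) * f (s *\<^sub>R u)) \<longlongrightarrow> Phi a u) (at_right 0)"
    by (rule rescaled_profile[OF q l p]) (rule that)
  define h where "h s u = s powr (- a) * f (s *\<^sub>R u)" for s u
  have fg: "exp_growth f" by (rule exp_growth_polynomial_tail[OF f q p])
  have hg: "exp_growth (h s)" if "s > 0" for s
  proof -
    have "exp_growth (\<lambda>u. s powr (- a) * f (s *\<^sub>R u))"
      using exp_growth_mult[OF exp_growth_const exp_growth_scaled_argument[OF fg], of s] that by simp
    then show ?thesis by (simp add: h_def[abs_def])
  qed
  define A where "A s \<xi> = (LINT u|lebesgue. exp (- (norm (u - \<xi>))\<^sup>2 / 4) * h s u)" for s \<xi>
  define Z where "Z = gauss_laplace (\<lambda>_::real^'n. 1::real) (0, 1/4)"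
  define Z1 where "Z1 = gauss_laplace (\<lambda>w::real^'n. norm w + real CARD('n)) (0, 1/4)"
  have Z: "Z > 0" unfolding Z_def by (rule gauss_mass_pos) simp
  define KB where "KB = (LINT u|lebesgue. exp (- (norm (u - 0))\<^sup>2 / 4) * B u)"
  \<comment> \<open>Solves c (|\<xi>| Z - Z1) <= KB for |\<xi>|; none of these constants depends on
    the time.\<close>
  define M where "M = (KB / c + Z1) / Z"
  have bdd: "norm (x t /\<^sub>R sqrt t) \<le> M" if t: "0 < t" "t < 1" for t
  proof -
    define s where "s = sqrt t"
    have s: "0 < s" "s \<le> 1" "s\<^sup>2 = t" using t by (auto simp: s_def)
    define \<xi> where "\<xi> = x t /\<^sub>R s"
    \<comment> \<open>The rescaling prefactor, with s^a undoing the normalization in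
      \<open>h\<close>; being positive, it cancels from the minimizing inequality.\<close>
    define K where "K = s ^ CARD('n) / (4 * pi * s\<^sup>2) powr (real CARD('n) / 2) * s powr a"
    have K: "K > 0" using s t by (simp add: K_def)
    have eq: "heat_reg f t (s *\<^sub>R \<xi>) = K * A s \<xi>" for \<xi>
    proof -
      have "A s \<xi> = s powr (- a) * (LINT u|lebesgue. exp (- (norm (u - \<xi>))\<^sup>2 / 4) * f (s *\<^sub>R u))"
        unfolding A_def h_def by (simp add: mult.left_commute)
      then show ?thesis
        using heat_reg_rescaled[OF f s(1), of \<xi>] s by (simp add: K_def powr_minus)
    qed
    have xt: "x t = s *\<^sub>R \<xi>" using s by (simp add: \<xi>_def)
    \<comment> \<open>The origin is the competitor: its average is bounded by \<open>KB\<close>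
      uniformly in the scale.\<close>
    have "heat_reg f t (x t) \<le> heat_reg f t (s *\<^sub>R 0)"
      using min[OF t(1)] by (auto simp: is_arg_min_def not_less)
    then have "A s \<xi> \<le> A s 0" unfolding xt eq using K by simp
    also have "A s 0 \<le> KB"
      unfolding A_def KB_def using upper[OF s(1,2)]
      by (intro integral_mono integrable_gaussian_shifted hg s B) (auto simp: h_def intro!: mult_left_mono)
    finally have "A s \<xi> \<le> KB" .
    moreover have "c * (norm \<xi> * Z - Z1) \<le> A s \<xi>"
      unfolding A_def Z_def Z1_def
      by (rule gauss_average_coercive[OF hg[OF s(1)] c]) (simp add: h_def lower s)
    ultimately have "c * (norm \<xi> * Z - Z1) \<le> KB" by linarith
    then show ?thesis using c Z by (simp add: M_def \<xi>_def s_def field_simps)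
  qed
  show ?thesis
  proof (rule ccontr)
    assume neg: "\<not> ?thesis"
    have "\<exists>t v. 0 < t \<and> t < 1 / real (Suc k) \<and> v \<noteq> 0 \<and>
        gauss_form (\<lambda>u. f (sqrt t *\<^sub>R u)) (x t /\<^sub>R sqrt t) v \<le> 0" for k
    proof -
      have "1 / real (Suc k) > 0" by simp
      then have "\<not> (\<forall>t\<in>{0<..<1 / real (Suc k)}. \<forall>v. v \<noteq> 0 \<longrightarrow>
        gauss_form (\<lambda>u. f (sqrt t *\<^sub>R u)) (x t /\<^sub>R sqrt t) v > 0)" using neg by blast
      then show ?thesis by (auto simp: not_less)
    qed
    then obtain t v where t: "\<And>k. 0 < t k" "\<And>k. t k < 1 / real (Suc k)"
      and v: "\<And>k. v k \<noteq> 0" and le: "\<And>k. gauss_form (\<lambda>u. f (sqrt (t k) *\<^sub>R u)) (x (t k) /\<^sub>R sqrt (t k)) (v k) \<le> 0"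
      by metis
    define s where "s k = sqrt (t k)" for k
    define \<xi> where "\<xi> k = x (t k) /\<^sub>R s k" for k
    \<comment> \<open>The form is homogeneous of degree two in the direction, so normalizing
      preserves its sign and places the directions in a compact sphere.\<close>
    define w where "w k = v k /\<^sub>R norm (v k)" for k
    have t1: "t k < 1" for k
      using t(2)[of k] by (rule less_le_trans) simp
    have s: "0 < s k" "s k \<le> 1" for k using t(1)[of k] t1[of k] by (auto simp: s_def)
    have nonpos: "gauss_form (h (s k)) (\<xi> k) (w k) \<le> 0" for k
    proof -
      have "gauss_form (h (s k)) (\<xi> k) (w k)
        = s k powr (- a) * ((inverse (norm (v k)))\<^sup>2 * gauss_form (\<lambda>u. f (s k *\<^sub>R u)) (\<xi> k) (v k))"
        unfolding h_def w_def gauss_form_cmult gauss_form_scaleR by (rule mult.left_commute)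
      also have "\<dots> \<le> 0" using le[of k]
        by (intro mult_nonneg_nonpos) (auto simp: s_def \<xi>_def)
      finally show ?thesis .
    qed
    have "(\<xi> k, w k) \<in> cball 0 M \<times> sphere 0 1" for k
      using bdd[OF t(1) t1, of k] v[of k] by (simp add: \<xi>_def s_def w_def)
    moreover have "compact (cball (0::real^'n) M \<times> sphere (0::real^'n) 1)"
      by (intro compact_Times compact_cball compact_sphere)
    ultimately obtain y \<phi> where y: "y \<in> cball 0 M \<times> sphere 0 1" and \<phi>: "strict_mono \<phi>"
      and ylim: "((\<lambda>k. (\<xi> k, w k)) \<circ> \<phi>) \<longlonglongrightarrow> y"
      using seq_compactE[OF compact_imp_seq_compact, of _ "\<lambda>k. (\<xi> k, w k)"] by blast
    have "(\<lambda>k. \<xi> (\<phi> k)) \<longlonglongrightarrow> fst y" "(\<lambda>k. w (\<phi> k)) \<longlonglongrightarrow> snd y"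
      using tendsto_fst[OF ylim] tendsto_snd[OF ylim] by (auto simp: o_def)
    moreover have "(\<lambda>k. h (s (\<phi> k)) u) \<longlonglongrightarrow> Phi a u" for u
    proof -
      have "t \<longlonglongrightarrow> 0"
        by (rule tendsto_sandwich[OF _ _ tendsto_const LIMSEQ_inverse_real_of_nat])
          (use t in \<open>auto intro!: always_eventually simp: less_imp_le inverse_eq_divide simp del: of_nat_Suc\<close>)
      then have "s \<longlonglongrightarrow> 0" unfolding s_def using tendsto_real_sqrt[of t 0] by simp
      moreover have "s k \<noteq> 0" for k using s(1)[of k] by simp
      ultimately have "filterlim s (at_right 0) sequentially"
        using s by (auto simp: filterlim_at)
      then have "filterlim (s \<circ> \<phi>) (at_right 0) sequentially"
        unfolding o_def by (rule filterlim_compose) (rule filterlim_subseq[OF \<phi>])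
      from filterlim_compose[OF lim this] show ?thesis by (simp add: h_def o_def)
    qed
    moreover have "\<bar>h (s (\<phi> k)) u\<bar> \<le> B u" for k u
      using upper[OF s, of "\<phi> k" u] quadratic_lower_bound_nonneg[OF q] by (simp add: h_def)
    moreover have "exp_growth (Phi a :: real ^ 'n \<Rightarrow> real)"
      using Phi_exp_growth[of a 0] a by simp
    ultimately have "(\<lambda>k. gauss_form (h (s (\<phi> k))) (\<xi> (\<phi> k)) (w (\<phi> k))) \<longlonglongrightarrow> gauss_form (Phi a) (fst y) (snd y)"
      by (intro gauss_form_tendsto[OF _ _ B] exp_growth_measurable hg s) auto
    then have "gauss_form (Phi a) (fst y) (snd y) \<le> 0"
      by (rule LIMSEQ_le_const2) (use nonpos in auto)
    moreover have "gauss_form (Phi a) (fst y) (snd y) > 0"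
      using y by (intro gauss_form_Phi_pos a) auto
    ultimately show False by simp
  qed
qed

section \<open>The critical point equation in Laplace coordinates\<close>

definition crit_map :: "('a::euclidean_space \<Rightarrow> real) \<Rightarrow> 'a \<times> real \<Rightarrow> 'a" where
  "crit_map f z = (2 * snd z) *\<^sub>R gauss_laplace (\<lambda>u. f u *\<^sub>R u) z - gauss_laplace f z *\<^sub>R fst z"

definition crit_deriv :: "('a::euclidean_space \<Rightarrow> real) \<Rightarrow> 'a \<times> real \<Rightarrow> 'a \<times> real \<Rightarrow> 'a" where
  "crit_deriv f z h =
     (2 * snd h) *\<^sub>R gauss_laplace (\<lambda>u. f u *\<^sub>R u) z
     + (2 * snd z) *\<^sub>R gauss_laplace (\<lambda>u. phase h u *\<^sub>R f u *\<^sub>R u) z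
     - gauss_laplace (\<lambda>u. phase h u * f u) z *\<^sub>R fst z
     - gauss_laplace f z *\<^sub>R fst h"

lemma exp_growth_scaleR_ident: "exp_growth f \<Longrightarrow> exp_growth (\<lambda>u. f u *\<^sub>R u)"
  by (rule exp_growth_scaleR) auto

lemma has_derivative_crit_map:
  assumes z: "snd z > 0" and f: "exp_growth f"
  shows "(crit_map f has_derivative crit_deriv f z) (at z)"
proof -
  have 1: "((\<lambda>z. 2 * snd z) has_derivative (\<lambda>h. 2 * snd h)) (at z)"
    by (auto intro!: derivative_eq_intros)
  have 2: "(fst has_derivative fst) (at z)"
    by (auto intro!: derivative_eq_intros)
  note d = has_derivative_diff[OF
      has_derivative_scaleR[OF 1 has_derivative_gauss_laplace[OF z exp_growth_scaleR_ident[OF f]]]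
      has_derivative_scaleR[OF has_derivative_gauss_laplace[OF z f] 2]]
  show ?thesis
    unfolding crit_map_def[abs_def]
    by (rule has_derivative_eq_rhs[OF d]) (auto simp: crit_deriv_def fun_eq_iff algebra_simps)
qed

lemma bounded_linear_crit_deriv: "snd z > 0 \<Longrightarrow> exp_growth f \<Longrightarrow> bounded_linear (crit_deriv f z)"
  using has_derivative_bounded_linear[OF has_derivative_crit_map] .

lemma continuous_on_crit_deriv:
  assumes f: "exp_growth f"
  shows "continuous_on {z. snd z > 0} (\<lambda>z. crit_deriv f z h)"
  unfolding crit_deriv_def
  by (intro continuous_intros continuous_on_gauss_laplace exp_growth_scaleR_ident f
      exp_growth_scaleR[OF exp_growth_phase] exp_growth_mult[OF exp_growth_phase])

text \<open>The Laplace coordinates $(b,s)$ of the pair $(t,x)$.\<close>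

definition branch_coord :: "real \<Rightarrow> 'a::euclidean_space \<Rightarrow> 'a \<times> real" where
  "branch_coord t x = ((1 / (2 * t)) *\<^sub>R x, 1 / (4 * t))"

definition heat_weight :: "real \<Rightarrow> real ^ 'n \<Rightarrow> real" where
  "heat_weight t x = 1 / (4 * pi * t) powr (real CARD('n) / 2) * exp (- (norm x)\<^sup>2 / (4 * t))"

lemma heat_weight_pos: "t > 0 \<Longrightarrow> heat_weight t x > 0"
  by (simp add: heat_weight_def)

lemma heat_reg_eq_laplace:
  assumes t: "t > 0"
  shows "heat_reg f t x = heat_weight t x * gauss_laplace f (branch_coord t x)"
proof -
  have k: "heat_kernel t (x - y) * f y = heat_weight t x * (exp (phase (branch_coord t x) y) *\<^sub>R f y)" for y
  proof -
    have "- (norm (x - y))\<^sup>2 / (4 * t) = - (norm x)\<^sup>2 / (4 * t) + phase (branch_coord t x) y"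
      unfolding phase_def branch_coord_def power2_norm_eq_inner
      using t by (simp add: inner_simps inner_commute field_simps)
    then have "exp (- (norm (x - y))\<^sup>2 / (4 * t)) = exp (- (norm x)\<^sup>2 / (4 * t)) * exp (phase (branch_coord t x) y)"
      by (simp only: exp_add)
    then show ?thesis by (simp add: heat_kernel_def heat_weight_def)
  qed
  show ?thesis
    unfolding heat_reg_def gauss_laplace_def k by (rule integral_mult_right_zero)
qed

lemma has_derivative_branch_coord:
  "(branch_coord t has_derivative (\<lambda>h. ((1 / (2 * t)) *\<^sub>R h, 0))) (at x)"
  unfolding branch_coord_def[abs_def] by (auto intro!: derivative_eq_intros)

lemma has_derivative_heat_weight:
  assumes t: "t > 0"
  shows "(heat_weight t has_derivative (\<lambda>h. - heat_weight t x * (x \<bullet> h) / (2 * t))) (at x)"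
  unfolding heat_weight_def[abs_def] power2_norm_eq_inner
  using t by (auto intro!: derivative_eq_intros simp: fun_eq_iff field_simps inner_commute)

text \<open>The weight contributes the factor -x/(2t) = -b, the Laplace integral contributes its
  first moment times 1/(2t) = 2s; together they form \<open>crit_map\<close>.\<close>

lemma GDERIV_heat_reg:
  assumes t: "t > 0" and f: "exp_growth f"
  shows "GDERIV (heat_reg f t) x :> heat_weight t x *\<^sub>R crit_map f (branch_coord t x)"
proof -
  let ?z = "branch_coord t x"
  have z: "snd ?z > 0" using t by (simp add: branch_coord_def)
  have 1: "((\<lambda>x. gauss_laplace f (branch_coord t x)) has_derivative
      (\<lambda>h. gauss_laplace (\<lambda>u. phase ((1 / (2 * t)) *\<^sub>R h, 0) u *\<^sub>R f u) ?z)) (at x)"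
    by (rule has_derivative_compose[OF has_derivative_branch_coord has_derivative_gauss_laplace[OF z f]])
  have L: "gauss_laplace (\<lambda>u. phase ((1 / (2 * t)) *\<^sub>R h, 0) u *\<^sub>R f u) ?z
      = (h \<bullet> gauss_laplace (\<lambda>u. f u *\<^sub>R u) ?z) / (2 * t)" for h
  proof -
    have "gauss_laplace (\<lambda>u. phase ((1 / (2 * t)) *\<^sub>R h, 0) u *\<^sub>R f u) ?z
      = gauss_laplace (\<lambda>u. (1 / (2 * t)) * (h \<bullet> (f u *\<^sub>R u))) ?z"
      by (simp add: phase_def mult.commute)
    then show ?thesis
      using gauss_laplace_inner[OF z exp_growth_scaleR_ident[OF f], of h]
      by (simp only: gauss_laplace_mult_const) simp
  qed
  have "((\<lambda>x. heat_weight t x * gauss_laplace f (branch_coord t x)) has_derivative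
      (\<lambda>h. h \<bullet> (heat_weight t x *\<^sub>R crit_map f ?z))) (at x)"
    by (rule has_derivative_eq_rhs[OF has_derivative_mult[OF has_derivative_heat_weight[OF t] 1[unfolded L]]])
      (use t in \<open>auto simp: crit_map_def fun_eq_iff inner_simps branch_coord_def inner_commute field_simps\<close>)
  moreover have "heat_reg f t = (\<lambda>x. heat_weight t x * gauss_laplace f (branch_coord t x))"
    using heat_reg_eq_laplace[OF t] by (intro ext)
  ultimately show ?thesis unfolding gderiv_def by simp
qed

lemma GDERIV_heat_reg_0_iff:
  assumes t: "t > 0" and f: "exp_growth f"
  shows "GDERIV (heat_reg f t) x :> 0 \<longleftrightarrow> crit_map f (branch_coord t x) = 0"
proof
  assume "GDERIV (heat_reg f t) x :> 0"
  then have "(\<lambda>h. h \<bullet> (heat_weight t x *\<^sub>R crit_map f (branch_coord t x))) = (\<lambda>h. h \<bullet> 0)"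
    using GDERIV_heat_reg[OF t f, of x] unfolding gderiv_def by (intro has_derivative_unique)
  then have "heat_weight t x *\<^sub>R crit_map f (branch_coord t x) = 0"
    by (metis inner_eq_zero_iff inner_zero_right)
  then show "crit_map f (branch_coord t x) = 0" using heat_weight_pos[OF t, of x] by simp
next
  assume "crit_map f (branch_coord t x) = 0"
  then show "GDERIV (heat_reg f t) x :> 0" using GDERIV_heat_reg[OF t f, of x] by simp
qed

text \<open>At a critical point the first moment is the total mass times b/(2s), which is the point
  x itself in the original coordinates.\<close>

lemma gauss_laplace_first_moment:
  assumes z: "snd z > 0" and f: "exp_growth f" and crit: "crit_map f z = 0"
  shows "gauss_laplace (\<lambda>u. (v \<bullet> u) * f u) z = gauss_laplace f z * (v \<bullet> fst z) / (2 * snd z)"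
proof -
  have "(2 * snd z) *\<^sub>R gauss_laplace (\<lambda>u. f u *\<^sub>R u) z = gauss_laplace f z *\<^sub>R fst z"
    using crit by (simp add: crit_map_def)
  from arg_cong[OF this, of "inner v"] show ?thesis
    using gauss_laplace_inner[OF z exp_growth_scaleR_ident[OF f], of v] z
    by (simp add: field_simps)
qed

text \<open>The product rule leaves a first moment in \<open>v\<close> times
  \<open>w \<bullet> fst z\<close>, which is not symmetric as it stands. Substituting the critical
  first moment makes the expression symmetric in \<open>v\<close> and \<open>w\<close>, whence the
  symmetry of the Hessian.\<close>

lemma inner_crit_deriv:
  assumes z: "snd z > 0" and f: "exp_growth f" and crit: "crit_map f z = 0"
  shows "w \<bullet> crit_deriv f z (v, 0) =
    2 * snd z * gauss_laplace (\<lambda>u. (v \<bullet> u) * ((w \<bullet> u) * f u)) z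
    - gauss_laplace f z * (v \<bullet> fst z) * (w \<bullet> fst z) / (2 * snd z)
    - gauss_laplace f z * (w \<bullet> v)"
proof -
  have g: "exp_growth (\<lambda>u. (v \<bullet> u) *\<^sub>R f u *\<^sub>R u)"
    by (intro exp_growth_scaleR exp_growth_scaleR_ident f) auto
  have "w \<bullet> gauss_laplace (\<lambda>u. (v \<bullet> u) *\<^sub>R f u *\<^sub>R u) z = gauss_laplace (\<lambda>u. (v \<bullet> u) * ((w \<bullet> u) * f u)) z"
    unfolding gauss_laplace_inner[OF z g] by (simp add: mult_ac)
  moreover note gauss_laplace_first_moment[OF z f crit, of v]
  ultimately show ?thesis
    using z by (simp add: crit_deriv_def phase_def inner_simps field_simps)
qed

text \<open>Carries the small-time positivity, proved for the integral form of the rescaled profile,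
  over to the derivative needed by the inverse function theorem.\<close>

lemma gauss_form_crit_deriv:
  fixes f :: "'a::euclidean_space \<Rightarrow> real"
  assumes t: "t > 0" and f: "exp_growth f" and crit: "crit_map f (branch_coord t x) = 0"
  shows "sqrt t ^ DIM('a) * gauss_form (\<lambda>u. f (sqrt t *\<^sub>R u)) (x /\<^sub>R sqrt t) v
    = exp (- (norm x)\<^sup>2 / (4 * t)) * (v \<bullet> crit_deriv f (branch_coord t x) (v, 0))"
proof -
  let ?z = "branch_coord t x"
  define s where "s = sqrt t"
  have s: "s > 0" "s\<^sup>2 = t" using t by (auto simp: s_def)
  have z: "snd ?z > 0" using t by (simp add: branch_coord_def)
  define q where "q y = (v \<bullet> (y - x))\<^sup>2 / (2 * t) - (norm v)\<^sup>2" for y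
  define E where "E = exp (- (norm x)\<^sup>2 / (4 * t))"
  have vf: "exp_growth (\<lambda>u. (v \<bullet> u) * f u)" by (intro exp_growth_mult f) auto
  have vvf: "exp_growth (\<lambda>u. (v \<bullet> u) * ((v \<bullet> u) * f u))" by (intro exp_growth_mult vf) auto
  \<comment> \<open>Split into moments of order two, one and zero; at a critical point the first is
    a multiple of the zeroth, and the sum collapses to the formula for
    \<open>crit_deriv\<close>.\<close>
  have qeq: "(\<lambda>y. q y * f y) = (\<lambda>y. (1 / (2 * t)) * ((v \<bullet> y) * ((v \<bullet> y) * f y))
      + ((- (v \<bullet> x) / t) * ((v \<bullet> y) * f y) + ((v \<bullet> x)\<^sup>2 / (2 * t) - (norm v)\<^sup>2) * f y))"
    using t by (auto simp: q_def fun_eq_iff inner_simps power2_eq_square field_simps)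
  have qf: "exp_growth (\<lambda>y. q y * f y)"
    unfolding qeq by (intro exp_growth_add exp_growth_mult vf vvf f) auto
  have L: "gauss_laplace (\<lambda>y. q y * f y) ?z = (1 / (2 * t)) * gauss_laplace (\<lambda>u. (v \<bullet> u) * ((v \<bullet> u) * f u)) ?z
      + (- (v \<bullet> x) / t) * gauss_laplace (\<lambda>u. (v \<bullet> u) * f u) ?z
      + ((v \<bullet> x)\<^sup>2 / (2 * t) - (norm v)\<^sup>2) * gauss_laplace f ?z"
    unfolding qeq
    by (subst gauss_laplace_add[OF z] gauss_laplace_mult_const;
        (intro exp_growth_add exp_growth_mult vf vvf f exp_growth_const)?)+ simp
  have L1: "gauss_laplace (\<lambda>u. (v \<bullet> u) * f u) ?z = (v \<bullet> x) * gauss_laplace f ?z"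
    using gauss_laplace_first_moment[OF z f crit, of v] t
    by (simp add: branch_coord_def)
  define F where "F y = E * (exp (phase ?z y) *\<^sub>R (q y * f y))" for y
  have F: "F \<in> borel_measurable lebesgue"
    unfolding F_def[abs_def]
    using borel_measurable_times[OF borel_measurable_const measurable_gauss_laplace_integrand[OF qf, of ?z], of E] .
  have Fs: "F (s *\<^sub>R u) = exp (- (norm (u - x /\<^sub>R s))\<^sup>2 / 4) * (((v \<bullet> (u - x /\<^sub>R s))\<^sup>2 / 2 - (norm v)\<^sup>2) * f (s *\<^sub>R u))" for u
  proof -
    have e: "s *\<^sub>R u - x = s *\<^sub>R (u - x /\<^sub>R s)" using s by (simp add: algebra_simps)
    have "q (s *\<^sub>R u) = (v \<bullet> (u - x /\<^sub>R s))\<^sup>2 / 2 - (norm v)\<^sup>2"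
      unfolding q_def e using s t by (simp add: power_mult_distrib flip: s(2))
    moreover have "E * exp (phase ?z (s *\<^sub>R u)) = exp (- (norm (u - x /\<^sub>R s))\<^sup>2 / 4)"
    proof -
      have "- (norm x)\<^sup>2 / (4 * t) + phase ?z (s *\<^sub>R u) = - (norm (s *\<^sub>R u - x))\<^sup>2 / (4 * t)"
        unfolding phase_def branch_coord_def power2_norm_eq_inner
        using t by (simp add: inner_simps inner_commute field_simps)
      also have "\<dots> = - (norm (u - x /\<^sub>R s))\<^sup>2 / 4"
        unfolding e using s t by (simp add: power_mult_distrib flip: s(2))
      finally show ?thesis by (simp add: E_def flip: exp_add)
    qed
    ultimately show ?thesis by (simp add: F_def flip: mult.assoc)
  qed
  have "s ^ DIM('a) * gauss_form (\<lambda>u. f (s *\<^sub>R u)) (x /\<^sub>R s) v = (LINT y|lebesgue. F y)"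
    using lebesgue_integral_affine[OF _ F, of s 0] s by (simp add: Fs gauss_form_def)
  also have "\<dots> = E * gauss_laplace (\<lambda>y. q y * f y) ?z"
    unfolding F_def gauss_laplace_def by (rule integral_mult_right_zero)
  also have "gauss_laplace (\<lambda>y. q y * f y) ?z = v \<bullet> crit_deriv f ?z (v, 0)"
    unfolding L L1 inner_crit_deriv[OF z f crit] using t
    by (simp add: branch_coord_def dot_square_norm power2_eq_square field_simps)
  finally show ?thesis by (simp add: s_def E_def)
qed

lemma has_hessian_heat_reg:
  fixes f :: "real ^ 'n \<Rightarrow> real"
  assumes t: "t > 0" and f: "exp_growth f" and crit: "crit_map f (branch_coord t x) = 0"
    and pos: "\<And>v. v \<noteq> 0 \<Longrightarrow> v \<bullet> crit_deriv f (branch_coord t x) (v, 0) > 0"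
  shows "\<exists>H. has_hessian (heat_reg f t) x H \<and> pos_definite H"
proof -
  let ?z = "branch_coord t x"
  have z: "snd ?z > 0" using t by (simp add: branch_coord_def)
  \<comment> \<open>The factor 1/(2t) comes from b = x/(2t). The derivative of the weight multiplies
    \<open>crit_map\<close>, which is zero here.\<close>
  define k where "k = heat_weight t x / (2 * t)"
  have k: "k > 0" using heat_weight_pos[OF t, of x] t by (simp add: k_def)
  define T where "T v = k *\<^sub>R crit_deriv f ?z (v, 0)" for v
  have "((\<lambda>x. crit_map f (branch_coord t x)) has_derivative
      (\<lambda>h. crit_deriv f ?z ((1 / (2 * t)) *\<^sub>R h, 0))) (at x)"
    by (rule has_derivative_compose[OF has_derivative_branch_coord has_derivative_crit_map[OF z f]])
  from has_derivative_scaleR[OF has_derivative_heat_weight[OF t] this]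
  have D: "((\<lambda>x. heat_weight t x *\<^sub>R crit_map f (branch_coord t x)) has_derivative T) (at x)"
  proof (rule has_derivative_eq_rhs)
    have "crit_deriv f ?z ((1 / (2 * t)) *\<^sub>R h, 0) = (1 / (2 * t)) *\<^sub>R crit_deriv f ?z (h, 0)" for h
      using linear_cmul[OF bounded_linear.linear[OF bounded_linear_crit_deriv[OF z f]], of "1 / (2 * t)" "(h, 0)"]
      by simp
    then show "(\<lambda>h. heat_weight t x *\<^sub>R crit_deriv f ?z ((1 / (2 * t)) *\<^sub>R h, 0) +
        (- heat_weight t x * (x \<bullet> h) / (2 * t)) *\<^sub>R crit_map f ?z) = T"
      by (auto simp: T_def k_def crit)
  qed
  define H where "H = matrix T"
  have H: "H *v v = T v" for v
    unfolding H_def using matrix_vector_mul(3)[OF has_derivative_bounded_linear[OF D]] by metis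
  have "has_hessian (heat_reg f t) x H"
    unfolding has_hessian_def
  proof (intro exI conjI)
    show "\<forall>\<^sub>F y in nhds x. GDERIV (heat_reg f t) y :> heat_weight t y *\<^sub>R crit_map f (branch_coord t y)"
      using GDERIV_heat_reg[OF t f] by simp
    show "((\<lambda>x. heat_weight t x *\<^sub>R crit_map f (branch_coord t x)) has_derivative (*v) H) (at x)"
      using D H by (metis (no_types, lifting) ext)
  qed
  moreover have "pos_definite H"
    unfolding pos_definite_def
  proof (intro conjI allI impI)
    have sym: "w \<bullet> T v = v \<bullet> T w" for v w
      unfolding T_def inner_scaleR_right inner_crit_deriv[OF z f crit]
      by (simp add: mult_ac inner_commute)
    have e: "H $ i $ j = axis i 1 \<bullet> (H *v axis j 1)" for i j
      by (simp add: inner_axis matrix_vector_mul_component)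
    show "transpose H = H"
      unfolding vec_eq_iff transpose_def
      by (simp only: vec_lambda_beta e H sym) simp
    show "v \<bullet> (H *v v) > 0" if "v \<noteq> 0" for v
      using pos[OF that] k by (simp add: H T_def)
  qed
  ultimately show ?thesis by blast
qed

text \<open>Needed for the branch to be C^1, since its derivative involves the inverse of the
  linearization. From F(x) w(x) = F(x0) w(x0) one gets F(x)(w(x) - w(x0)) = -(F(x) - F(x0)) w(x0),
  and F(x) inherits a lower bound from the injective map F(x0).\<close>

lemma continuous_on_inv_blinfun:
  fixes F :: "'a::topological_space \<Rightarrow> 'b::euclidean_space \<Rightarrow>\<^sub>L 'b"
  assumes F: "continuous_on S F" and bij: "\<And>x. x \<in> S \<Longrightarrow> bij (blinfun_apply (F x))"
  shows "continuous_on S (\<lambda>x. inv (blinfun_apply (F x)) b)"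
  unfolding continuous_on_def
proof
  fix x0 assume x0: "x0 \<in> S"
  define w where "w x = inv (blinfun_apply (F x)) b" for x
  have Fw: "F x (w x) = b" if "x \<in> S" for x
    unfolding w_def using bij[OF that] by (simp add: bij_is_surj surj_f_inv_f)
  obtain B where B: "B > 0" "\<And>v. B * norm v \<le> norm (F x0 v)"
    using linear_inj_bounded_below_pos[OF bounded_linear.linear[OF blinfun.bounded_linear_right] bij_is_inj[OF bij[OF x0]]]
    by metis
  have lim: "(F \<longlongrightarrow> F x0) (at x0 within S)" using F x0 by (simp add: continuous_on_def)
  then have lim0: "((\<lambda>x. norm (F x - F x0)) \<longlongrightarrow> 0) (at x0 within S)"
    using LIM_zero[of F] tendsto_norm_zero by blast
  have "\<forall>\<^sub>F x in at x0 within S. norm (F x - F x0) < B / 2"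
    using order_tendstoD(2)[OF lim0, of "B / 2"] B by simp
  moreover have "\<forall>\<^sub>F x in at x0 within S. x \<in> S" by (simp add: eventually_at_topological) (use x0 in blast)
  ultimately have "\<forall>\<^sub>F x in at x0 within S. norm (w x - w x0) \<le> (2 / B * norm (w x0)) * norm (F x - F x0)"
  proof eventually_elim
    case (elim x)
    let ?d = "w x - w x0"
    have "F x ?d = - (F x - F x0) (w x0)"
      using Fw[OF elim(2)] Fw[OF x0] by (simp add: blinfun.diff_right blinfun.diff_left)
    then have 1: "norm (F x ?d) \<le> norm (F x - F x0) * norm (w x0)"
      using norm_blinfun[of "F x - F x0" "w x0"] by simp
    have "norm (F x0 ?d) \<le> norm (F x ?d) + norm ((F x - F x0) ?d)"
      using norm_triangle_ineq4[of "F x ?d" "(F x - F x0) ?d"] by (simp add: blinfun.diff_left)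
    also have "norm ((F x - F x0) ?d) \<le> B / 2 * norm ?d"
      using elim by (intro order_trans[OF norm_blinfun mult_right_mono]) auto
    finally have "B / 2 * norm ?d \<le> norm (F x - F x0) * norm (w x0)"
      using 1 B(2)[of ?d] by linarith
    then show ?case using B(1) by (simp add: field_simps)
  qed
  then have "((\<lambda>x. w x - w x0) \<longlongrightarrow> 0) (at x0 within S)"
  proof (rule Lim_null_comparison)
    show "((\<lambda>x. (2 / B * norm (w x0)) * norm (F x - F x0)) \<longlongrightarrow> 0) (at x0 within S)"
      using lim0 by (rule tendsto_mult_right_zero)
  qed
  then show "((\<lambda>x. inv (blinfun_apply (F x)) b) \<longlongrightarrow> inv (blinfun_apply (F x0)) b) (at x0 within S)"
    unfolding w_def[symmetric] by (rule LIM_zero_cancel)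
qed

text \<open>The form at \<open>z0\<close> has a positive minimum on the unit sphere, and an operator
  perturbation of smaller norm cannot destroy positivity.\<close>

lemma quadratic_form_pos_open:
  fixes G :: "'z::topological_space \<Rightarrow> 'b::euclidean_space \<Rightarrow>\<^sub>L 'b"
  assumes U: "open U" "z0 \<in> U" and G: "continuous_on U G"
    and pos: "\<And>v. v \<noteq> 0 \<Longrightarrow> v \<bullet> G z0 v > 0"
  shows "\<exists>W. open W \<and> z0 \<in> W \<and> W \<subseteq> U \<and> (\<forall>z\<in>W. \<forall>v. v \<noteq> 0 \<longrightarrow> v \<bullet> G z v > 0)"
proof -
  have "sphere (0::'b) 1 \<noteq> {}"
    using nonempty_Basis norm_Basis by (metis dist_0_norm empty_iff ex_in_conv mem_sphere)
  then have "\<exists>v0\<in>sphere 0 1. \<forall>v\<in>sphere 0 1. v0 \<bullet> G z0 v0 \<le> v \<bullet> G z0 v"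
    by (intro continuous_attains_inf continuous_intros) auto
  then obtain v0 where v0: "v0 \<in> sphere 0 1" "\<And>v. v \<in> sphere 0 1 \<Longrightarrow> v0 \<bullet> G z0 v0 \<le> v \<bullet> G z0 v"
    by blast
  define \<mu> where "\<mu> = v0 \<bullet> G z0 v0"
  have \<mu>: "\<mu> > 0" unfolding \<mu>_def using v0(1) by (intro pos) auto
  have low: "\<mu> * (norm v)\<^sup>2 \<le> v \<bullet> G z0 v" for v
  proof (cases "v = 0")
    case False
    then have "\<mu> \<le> (v /\<^sub>R norm v) \<bullet> G z0 (v /\<^sub>R norm v)" unfolding \<mu>_def by (intro v0(2)) auto
    also have "\<dots> = (v \<bullet> G z0 v) / (norm v)\<^sup>2"
      by (simp add: blinfun.scaleR_right field_simps power2_eq_square)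
    finally show ?thesis using False by (simp add: field_simps)
  qed simp
  have cont: "continuous_on U (\<lambda>z. norm (G z - G z0))" using G by (intro continuous_intros)
  define W where "W = {z \<in> U. norm (G z - G z0) < \<mu>}"
  have "open W"
    using continuous_open_preimage[OF cont U(1), of "{..<\<mu>}"] by (auto simp: W_def vimage_def Collect_conj_eq)
  moreover have "z0 \<in> W" using U \<mu> by (simp add: W_def)
  moreover have "v \<bullet> G z v > 0" if z: "z \<in> W" and v: "v \<noteq> 0" for z v
  proof -
    have "\<bar>v \<bullet> (G z - G z0) v\<bar> \<le> norm v * (norm (G z - G z0) * norm v)"
      by (rule order_trans[OF Cauchy_Schwarz_ineq2]) (intro mult_left_mono norm_blinfun norm_ge_zero)
    also have "\<dots> = norm (G z - G z0) * (norm v)\<^sup>2" by (simp add: power2_eq_square)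
    also have "\<dots> < \<mu> * (norm v)\<^sup>2" using z v by (intro mult_strict_right_mono) (auto simp: W_def)
    finally have "\<bar>v \<bullet> G z v - v \<bullet> G z0 v\<bar> < \<mu> * (norm v)\<^sup>2"
      by (simp add: blinfun.diff_left inner_diff_right)
    then show ?thesis using low[of v] by linarith
  qed
  ultimately show ?thesis by (intro exI[of _ W]) (auto simp: W_def)
qed

section \<open>The branch\<close>

lemma branch_coord_simps [simp]:
  "fst (branch_coord t x) = (1 / (2 * t)) *\<^sub>R x" "snd (branch_coord t x) = 1 / (4 * t)"
  by (simp_all add: branch_coord_def)

lemma critical_branch_exists_unique:
  fixes f :: "real ^ 'n \<Rightarrow> real"
  assumes f: "exp_growth f" and ts: "ts > 0" and crit: "crit_map f (branch_coord ts x0) = 0"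
    and pos: "\<And>v. v \<noteq> 0 \<Longrightarrow> v \<bullet> crit_deriv f (branch_coord ts x0) (v, 0) > 0"
  shows "\<exists>\<epsilon>>0. \<epsilon> \<le> ts \<and>
    (\<exists>y. critical_point_branch f {ts - \<epsilon><..<ts + \<epsilon>} y \<and> y ts = x0 \<and>
       (\<forall>z. critical_point_branch f {ts - \<epsilon><..<ts + \<epsilon>} z \<and> z ts = x0 \<longrightarrow>
            (\<forall>t\<in>{ts - \<epsilon><..<ts + \<epsilon>}. z t = y t)) \<and>
       nondegenerate_local_minimizing_branch f {ts - \<epsilon><..<ts + \<epsilon>} y)"
proof -
  define z0 where "z0 = branch_coord ts x0"
  define U where "U = {z :: (real ^ 'n) \<times> real. snd z > 0}"
  have U: "open U" unfolding U_def by (intro open_Collect_less continuous_intros)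
  have z0U: "z0 \<in> U" using ts by (simp add: U_def z0_def)
  define G where "G z = (crit_map f z, snd z)" for z
  define G' where "G' z = Blinfun (\<lambda>h. (crit_deriv f z h, snd h))" for z
  have blG: "bounded_linear (\<lambda>h. (crit_deriv f z h, snd h))" if "z \<in> U" for z
    using that f by (intro bounded_linear_Pair bounded_linear_crit_deriv bounded_linear_snd) (auto simp: U_def)
  have G'_apply: "blinfun_apply (G' z) h = (crit_deriv f z h, snd h)" if "z \<in> U" for z h
    unfolding G'_def by (simp add: bounded_linear_Blinfun_apply[OF blG[OF that]])
  have derG: "(G has_derivative blinfun_apply (G' z)) (at z)" if "z \<in> U" for z
  proof -
    have "(G has_derivative (\<lambda>h. (crit_deriv f z h, snd h))) (at z)"
      unfolding G_def[abs_def] using that f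
      by (intro has_derivative_Pair has_derivative_crit_map has_derivative_snd has_derivative_ident) (auto simp: U_def)
    then show ?thesis by (simp add: G'_def bounded_linear_Blinfun_apply[OF blG[OF that]])
  qed
  have contG: "continuous_on U G'"
  proof (rule continuous_on_blinfun_componentwise)
    fix i
    have "continuous_on U (\<lambda>z. (crit_deriv f z i, snd i))"
      using continuous_on_crit_deriv[OF f] by (intro continuous_intros) (auto simp: U_def)
    then show "continuous_on U (\<lambda>z. blinfun_apply (G' z) i)"
      by (rule continuous_on_eq) (simp add: G'_apply)
  qed
  \<comment> \<open>The second component forces a kernel vector into the form (v, 0), and positive
    definiteness then gives v = 0.\<close>
  have "inj (blinfun_apply (G' z0))"
    unfolding linear_injective_0[OF bounded_linear.linear[OF blinfun.bounded_linear_right]]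
  proof (intro allI impI)
    fix h assume "blinfun_apply (G' z0) h = 0"
    then have h: "crit_deriv f z0 h = 0" "snd h = 0" using G'_apply[OF z0U, of h] by (auto simp: zero_prod_def)
    then have "h = (fst h, 0)" by (simp add: prod_eq_iff)
    then have "fst h \<bullet> crit_deriv f z0 (fst h, 0) = 0" using h by (metis inner_zero_right)
    then have "fst h = 0" using pos[of "fst h"] by (auto simp: z0_def)
    then show "h = 0" using h by (simp add: prod_eq_iff)
  qed
  then obtain inv0 where inv0: "linear inv0" "inv0 \<circ> blinfun_apply (G' z0) = id"
    using linear_injective_left_inverse[OF bounded_linear.linear[OF blinfun.bounded_linear_right]] by blast
  have "blinfun_apply (Blinfun inv0) = inv0"
    using inv0(1) by (intro bounded_linear_Blinfun_apply) (simp add: linear_conv_bounded_linear)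
  then have "Blinfun inv0 o\<^sub>L G' z0 = id_blinfun"
    using fun_cong[OF inv0(2)] by (intro blinfun_eqI) simp
  from inverse_function_theorem[OF U derG contG z0U this]
  obtain U' V g g' where U': "open U'" "U' \<subseteq> U" "z0 \<in> U'" and V: "open V" "G z0 \<in> V"
    and hom: "homeomorphism U' V G g"
    and dg: "\<And>w. w \<in> V \<Longrightarrow> (g has_derivative g' w) (at w)"
    and g': "\<And>w. w \<in> V \<Longrightarrow> g' w = inv (blinfun_apply (G' (g w)))"
    and bij: "\<And>w. w \<in> V \<Longrightarrow> bij (blinfun_apply (G' (g w)))"
    by metis
  have gU': "g w \<in> U'" "G (g w) = w" if "w \<in> V" for w
    using hom that by (auto simp: homeomorphism_def)
  have Gg: "g (G z) = z" "G z \<in> V" if "z \<in> U'" for z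
    using hom that by (auto simp: homeomorphism_def)
  have contg: "continuous_on V g" using hom by (simp add: homeomorphism_def)
  define P where "P z = Blinfun (\<lambda>v. crit_deriv f z (v, 0))" for z
  have blP: "bounded_linear (\<lambda>v. crit_deriv f z (v, 0))" if "z \<in> U" for z
    using bounded_linear_compose[OF bounded_linear_crit_deriv[OF _ f], of z "\<lambda>v. (v, 0)"] that
    by (simp add: U_def bounded_linear_Pair bounded_linear_ident bounded_linear_zero)
  have P_apply: "blinfun_apply (P z) v = crit_deriv f z (v, 0)" if "z \<in> U" for z v
    unfolding P_def by (simp add: bounded_linear_Blinfun_apply[OF blP[OF that]])
  have contP: "continuous_on U P"
  proof (rule continuous_on_blinfun_componentwise)
    fix i
    have "continuous_on U (\<lambda>z. crit_deriv f z (i, 0))"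
      using continuous_on_crit_deriv[OF f] by (auto simp: U_def)
    then show "continuous_on U (\<lambda>z. blinfun_apply (P z) i)"
      by (rule continuous_on_eq) (simp add: P_apply)
  qed
  obtain W where W: "open W" "z0 \<in> W" "W \<subseteq> U"
    and Wpos: "\<And>z v. z \<in> W \<Longrightarrow> v \<noteq> 0 \<Longrightarrow> v \<bullet> crit_deriv f z (v, 0) > 0"
    using quadratic_form_pos_open[OF U z0U contP] pos P_apply z0U unfolding z0_def
    by (metis (no_types, lifting) subsetD)
  \<comment> \<open>The curve of targets: points critical at time t are exactly those whose Laplace
    coordinates \<open>G\<close> sends to \<open>p t\<close>.\<close>
  define p where "p t = (0 :: real ^ 'n, 1 / (4 * t))" for t :: real
  have Gp: "G (branch_coord t x) = p t" if "crit_map f (branch_coord t x) = 0" for t x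
    using that by (simp add: G_def p_def)
  have pts: "p ts = G z0" using Gp crit by (simp add: z0_def)
  define T where "T = {t. t > 0 \<and> p t \<in> V \<inter> g -` W}"
  have openVW: "open (V \<inter> g -` W)" using continuous_open_preimage[OF contg V(1) W(1)] .
  have contp: "continuous_on {0<..} p" unfolding p_def by (intro continuous_intros) auto
  have "T = {0<..} \<inter> p -` (V \<inter> g -` W)" by (auto simp: T_def)
  then have "open T" using continuous_open_preimage[OF contp open_greaterThan openVW] by simp
  moreover have "ts \<in> T" using ts pts V(2) Gg[OF U'(3)] W(2) by (simp add: T_def)
  ultimately obtain e where e: "e > 0" "ball ts e \<subseteq> T" using open_contains_ball by blast
  \<comment> \<open>The radius \<open>e\<close> keeps \<open>p t\<close> in the domain of the local
    inverse and its image in \<open>W\<close>, where positivity holds; the bound by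
    \<open>ts\<close> keeps the interval in positive times.\<close>
  define \<epsilon> where "\<epsilon> = min e ts"
  have \<epsilon>: "\<epsilon> > 0" "\<epsilon> \<le> ts" using e ts by (auto simp: \<epsilon>_def)
  define J where "J = {ts - \<epsilon><..<ts + \<epsilon>}"
  have JT: "J \<subseteq> T"
    using e(2) by (force simp: J_def \<epsilon>_def dist_real_def)
  have tsJ: "ts \<in> J" using \<epsilon> by (simp add: J_def)
  have Jpos: "t > 0" and JV: "p t \<in> V" and JW: "g (p t) \<in> W" if "t \<in> J" for t
    using that JT by (auto simp: T_def)
  \<comment> \<open>Inverts b = x/(2t).\<close>
  define y where "y t = (2 * t) *\<^sub>R fst (g (p t))" for t
  have by_eq: "branch_coord t (y t) = g (p t)" if t: "t \<in> J" for t
  proof -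
    have "snd (g (p t)) = 1 / (4 * t)" using gU'(2)[OF JV[OF t]] by (simp add: G_def p_def prod_eq_iff)
    then show ?thesis using Jpos[OF t] by (simp add: prod_eq_iff y_def)
  qed
  have ycrit: "crit_map f (branch_coord t (y t)) = 0" if t: "t \<in> J" for t
    using gU'(2)[OF JV[OF t]] by (simp add: by_eq[OF t] G_def p_def prod_eq_iff)
  have yts: "y ts = x0"
  proof -
    have "g (p ts) = z0" using Gg(1)[OF U'(3)] by (simp add: pts)
    then show ?thesis using ts by (simp add: y_def z0_def)
  qed
  have C1: "y C1_differentiable_on J"
    unfolding C1_differentiable_on_def
  proof (intro exI conjI ballI)
    \<comment> \<open>The velocity of \<open>p\<close> is -1/(4t^2) times (0,1), so \<open>q\<close>
      is the only value of the inverse derivative that enters; the product rule then turns the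
      factor 2t into the coefficient -1/(2t).\<close>
    define q where "q t = inv (blinfun_apply (G' (g (p t)))) (0, 1)" for t
    have dp: "(p has_derivative (\<lambda>h. (0, - h / (4 * t\<^sup>2)))) (at t)" if "t > 0" for t
      unfolding p_def using that
      by (auto intro!: derivative_eq_intros simp: power2_eq_square field_simps)
    show "(y has_vector_derivative (2 *\<^sub>R fst (g (p t)) - (1 / (2 * t)) *\<^sub>R fst (q t))) (at t)" if t: "t \<in> J" for t
    proof -
      have "g' (p t) (0, - h / (4 * t\<^sup>2)) = (- h / (4 * t\<^sup>2)) *\<^sub>R q t" for h
        using linear_cmul[OF has_derivative_linear[OF dg[OF JV[OF t]]], of "- h / (4 * t\<^sup>2)" "(0, 1)"]
        by (simp add: q_def g'[OF JV[OF t]])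
      then have "((\<lambda>t. g (p t)) has_derivative (\<lambda>h. (- h / (4 * t\<^sup>2)) *\<^sub>R q t)) (at t)"
        using has_derivative_compose[OF dp[OF Jpos[OF t]] dg[OF JV[OF t]]] by simp
      from has_derivative_fst[OF this]
      have "((\<lambda>t. fst (g (p t))) has_derivative (\<lambda>h. (- h / (4 * t\<^sup>2)) *\<^sub>R fst (q t))) (at t)"
        by simp
      moreover have "((\<lambda>t. 2 * t) has_derivative (\<lambda>h. 2 * h)) (at t)"
        by (auto intro!: derivative_eq_intros)
      ultimately show ?thesis
        unfolding has_vector_derivative_def y_def[abs_def] using Jpos[OF t]
        by (intro has_derivative_eq_rhs[OF has_derivative_scaleR])
          (auto simp: fun_eq_iff algebra_simps power2_eq_square)
    qed
    have cp: "continuous_on J p" using contp by (rule continuous_on_subset) (auto simp: Jpos)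
    have cgp: "continuous_on J (\<lambda>t. g (p t))"
      by (rule continuous_on_compose2[OF contg cp]) (use JV in auto)
    have "continuous_on J (\<lambda>t. G' (g (p t)))"
      by (rule continuous_on_compose2[OF contG cgp]) (use JW W in auto)
    then have "continuous_on J q"
      unfolding q_def by (rule continuous_on_inv_blinfun) (use bij JV in auto)
    then show "continuous_on J (\<lambda>t. 2 *\<^sub>R fst (g (p t)) - (1 / (2 * t)) *\<^sub>R fst (q t))"
      using cgp Jpos by (intro continuous_intros) force+
  qed
  have branch: "critical_point_branch f J y"
    unfolding critical_point_branch_def
    using C1 ycrit Jpos GDERIV_heat_reg_0_iff[OF _ f] by (auto simp: J_def is_interval_def)
  have nondeg: "nondegenerate_local_minimizing_branch f J y"
    unfolding nondegenerate_local_minimizing_branch_def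
  proof (intro conjI branch ballI)
    fix t assume t: "t \<in> J"
    show "\<exists>H. has_hessian (heat_reg f t) (y t) H \<and> pos_definite H"
      by (rule has_hessian_heat_reg[OF Jpos[OF t] f ycrit[OF t]]) (simp add: by_eq[OF t] Wpos JW[OF t])
  qed
  have unique: "z t = y t" if z: "critical_point_branch f J z" "z ts = x0" and t: "t \<in> J" for z t
  proof -
    have zcrit: "crit_map f (branch_coord t (z t)) = 0" if "t \<in> J" for t
      using z(1) that GDERIV_heat_reg_0_iff[OF Jpos[OF that] f] by (auto simp: critical_point_branch_def)
    have zcont: "continuous_on J z"
      using z(1) C1_differentiable_imp_continuous_on by (auto simp: critical_point_branch_def)
    have ycont: "continuous_on J y" using C1 by (rule C1_differentiable_imp_continuous_on)
    \<comment> \<open>The coincidence set is closed by continuity. It is open because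
      \<open>G\<close> is injective on \<open>U'\<close> and both branches have image
      \<open>p t\<close>: they agree exactly when the coordinates of \<open>z t\<close> lie in the
      open set \<open>U'\<close>.\<close>
    define E where "E = {t \<in> J. z t - y t = 0}"
    have "closedin (top_of_set J) E"
      unfolding E_def using zcont ycont by (intro continuous_closedin_preimage_constant continuous_intros)
    moreover have "openin (top_of_set J) E"
    proof -
      have cz: "continuous_on J (\<lambda>t. branch_coord t (z t))"
        unfolding branch_coord_def using zcont Jpos by (intro continuous_intros) force+
      have "z t = y t \<longleftrightarrow> branch_coord t (z t) \<in> U'" if t: "t \<in> J" for t
      proof
        assume "z t = y t"
        then show "branch_coord t (z t) \<in> U'" using by_eq[OF t] gU'(1)[OF JV[OF t]] by simp
      next
        assume "branch_coord t (z t) \<in> U'"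
        then have "branch_coord t (z t) = g (p t)" using Gg(1) Gp[OF zcrit[OF t]] by metis
        then have "branch_coord t (z t) = branch_coord t (y t)" by (simp add: by_eq[OF t])
        then show "z t = y t" using Jpos[OF t] by (simp add: branch_coord_def)
      qed
      then have "E = J \<inter> (\<lambda>t. branch_coord t (z t)) -` U'" by (auto simp: E_def)
      then show ?thesis using continuous_openin_preimage_gen[OF cz U'(1)] by simp
    qed
    moreover have "ts \<in> E" using z(2) yts tsJ by (simp add: E_def)
    moreover have "connected J" by (simp add: J_def)
    ultimately have "E = J" unfolding connected_clopen by blast
    then show ?thesis using t by (auto simp: E_def)
  qed
  show ?thesis
    using \<epsilon> branch yts unique nondeg unfolding J_def by blast
qed

theorem proposition4p8:
  fixes f :: "real ^ 'n \<Rightarrow> real" and x :: "real \<Rightarrow> real ^ 'n"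
  assumes "f \<in> borel_measurable lebesgue"
    and "quadratic_lower_bound f"
    and "leading_order_profile f"
    and "polynomial_tail f"
    and "\<And>t. t > 0 \<Longrightarrow> is_arg_min (heat_reg f t) (\<lambda>_. True) (x t)"
  shows "\<exists>t0>0. \<forall>ts\<in>{0<..<t0}. \<exists>\<epsilon>>0. \<epsilon> \<le> ts \<and>
    (\<exists>y. critical_point_branch f {ts - \<epsilon><..<ts + \<epsilon>} y \<and> y ts = x ts \<and>
       (\<forall>z. critical_point_branch f {ts - \<epsilon><..<ts + \<epsilon>} z \<and> z ts = x ts \<longrightarrow>
            (\<forall>t\<in>{ts - \<epsilon><..<ts + \<epsilon>}. z t = y t)) \<and>
       nondegenerate_local_minimizing_branch f {ts - \<epsilon><..<ts + \<epsilon>} y)"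
proof -
  have f: "exp_growth f" by (rule exp_growth_polynomial_tail[OF assms(1,2,4)])
  obtain t0 where t0: "t0 > 0" and form: "\<And>t v. t \<in> {0<..<t0} \<Longrightarrow> v \<noteq> 0 \<Longrightarrow>
      gauss_form (\<lambda>u. f (sqrt t *\<^sub>R u)) (x t /\<^sub>R sqrt t) v > 0"
    using minimizer_form_pos[OF assms] by blast
  show ?thesis
  proof (rule exI[of _ t0], rule conjI[OF t0], rule ballI, rule critical_branch_exists_unique[OF f])
    fix t assume t: "t \<in> {0<..<t0}"
    then show "t > 0" by simp
    have "\<forall>y. heat_reg f t (x t) \<le> heat_reg f t y"
      using assms(5)[OF \<open>t > 0\<close>] by (auto simp: is_arg_min_def not_less)
    \<comment> \<open>First-order condition at a global minimizer; the positive weight is then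
      divided out.\<close>
    then have "(\<lambda>h. h \<bullet> (heat_weight t (x t) *\<^sub>R crit_map f (branch_coord t (x t)))) = (\<lambda>h. 0)"
      using GDERIV_heat_reg[OF \<open>t > 0\<close> f, of "x t"] unfolding gderiv_def
      by (intro has_derivative_local_min[where f = "heat_reg f t" and x = "x t"]) auto
    then have "heat_weight t (x t) *\<^sub>R crit_map f (branch_coord t (x t)) = 0"
      by (metis inner_eq_zero_iff)
    then show crit: "crit_map f (branch_coord t (x t)) = 0"
      using heat_weight_pos[OF \<open>t > 0\<close>, of "x t"] by simp
    fix v :: "real ^ 'n" assume "v \<noteq> 0"
    from form[OF t this] show "v \<bullet> crit_deriv f (branch_coord t (x t)) (v, 0) > 0"
      using gauss_form_crit_deriv[OF \<open>t > 0\<close> f crit, of v] \<open>t > 0\<close>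
      by (metis exp_gt_zero real_sqrt_gt_zero zero_less_mult_pos zero_less_power mult_pos_pos)
  qed
qed

end
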